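(* Let $T\in(0,\infty]$ and let $f:[0,T)\times I\to\mathbb{R}^d$ be a smooth family of immersed curves such that $f(t,0)=p_0$, $f(t,1)=p_1$ and $\mathcal{L}(f(t))>0$ for all $t\in[0,T)$. If $\tilde f(t)$ is the constant speed $\mathcal{L}(f(t))$ reparametrization of $f(t)$, then for all $t\in[0,T)$ $$\|\partial_t\tilde f(t)\|_{L^2(dx)}\le\sqrt{\frac{2}{\mathcal{L}(f(t))}+16\,\mathcal{E}(f(t))}\;\|\partial_tf\|_{L^2(ds_{f(t)})}.$$ In particular, if $f$ evolves by the length-preserving elastic flow (see context) with initial datum $f_0=f(0)$ and $\ell=\mathcal{L}(f_0)$, then $$\|\partial_t\tilde f(t)\|_{L^2(dx)}\le C\,\|\partial_tf\|_{L^2(ds_{f(t)})}\quad\text{for all }t\in[0,T),\qquad C=\sqrt{\tfrac{2}{\ell}+16\,\mathcal{E}(f_0)}.$$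
   Context: $I=[0,1]$, $d\ge2$, $p_0,p_1\in\mathbb{R}^d$. For an immersed curve $f:I\to\mathbb{R}^d$: $ds_f=|\partial_xf|dx$, $\partial_s=|\partial_xf|^{-1}\partial_x$, $\vec\kappa=\partial_s^2f$, $P^\perp X=X-\langle X,\partial_sf\rangle\partial_sf$, $\nabla_sX=P^\perp\partial_sX$; $\mathcal{E}(f)=\frac12\int_I|\vec\kappa|^2ds$, $\mathcal{L}(f)=\int_Ids$. The constant speed $\mathcal{L}(f(t))$ reparametrization is $\tilde f(t,x)=f(t,\psi(t,x))$, where $\psi(t,\cdot):I\to I$ is the inverse of $\varphi(t,x)=\frac1{\mathcal{L}(f(t))}\int_0^x|\partial_xf(t,z)|dz$. The length-preserving elastic flow is $$\partial_tf=-\nabla_s^2\vec\kappa-\tfrac12|\vec\kappa|^2\vec\kappa+\lambda\vec\kappa+\theta\,\partial_sf\ \text{ on }(0,T)\times I,\quad f(0,\cdot)=f_0,\quad f(t,y)=p_y,\ \partial_sf(t,y)=\tau_y\ (0\le t<T,\ y\in\partial I),$$ with $\theta=\langle\partial_tf,\partial_sf\rangle$, fixed $\tau_0,\tau_1\in\mathbb{S}^{d-1}$ and $$\lambda(f)(t)=\frac{\int_I\langle\nabla_s^2\vec\kappa+\frac12|\vec\kappa|^2\vec\kappa,\vec\kappa\rangle ds}{\int_I|\vec\kappa|^2ds},$$ where $f_0(y)=p_y$, $\partial_sf_0(y)=\tau_y$ for $y\in\partial I$ and $|p_0-p_1|<\mathcal{L}(f_0)$. *)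

theory Defs
  imports "HOL-Analysis.Analysis"
begin

(* A family of curves is a function f with f t x in R^d, used for t in [0,T) and x in [0,1];
   its values elsewhere are irrelevant. Derivatives in t and x are taken within these intervals,
   hence are one-sided at the endpoints. *)

definition time_dom :: "ereal \<Rightarrow> real set" where
  "time_dom T = {t. 0 \<le> t \<and> ereal t < T}"

definition dt :: "ereal \<Rightarrow> (real \<Rightarrow> real \<Rightarrow> 'a::real_normed_vector) \<Rightarrow> real \<Rightarrow> real \<Rightarrow> 'a" where
  "dt T f t x = vector_derivative (\<lambda>s. f s x) (at t within time_dom T)"

definition dx :: "(real \<Rightarrow> 'a::real_normed_vector) \<Rightarrow> real \<Rightarrow> 'a" where
  "dx X x = vector_derivative X (at x within {0..1})"

(* C^k and smooth on a set with (possibly) boundary such as [0,T) x [0,1]: all partial derivatives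
   up to order k exist, one-sided at the boundary, and are continuous up to the boundary.
   g1 and g2 are the first and second partial derivative of g. *)
primrec Ck_on :: "nat \<Rightarrow> (real \<times> real) set \<Rightarrow> (real \<times> real \<Rightarrow> 'a::real_normed_vector) \<Rightarrow> bool" where
  "Ck_on 0 S g \<longleftrightarrow> continuous_on S g"
| "Ck_on (Suc k) S g \<longleftrightarrow>
     (\<exists>g1 g2. Ck_on k S g1 \<and> Ck_on k S g2 \<and>
        (\<forall>z\<in>S. (g has_derivative (\<lambda>h. fst h *\<^sub>R g1 z + snd h *\<^sub>R g2 z)) (at z within S)))"

definition smooth_family :: "ereal \<Rightarrow> (real \<Rightarrow> real \<Rightarrow> 'a::real_normed_vector) \<Rightarrow> bool" where
  "smooth_family T f \<longleftrightarrow> (\<forall>k. Ck_on k (time_dom T \<times> {0..1}) (\<lambda>(t, x). f t x))"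

definition immersed :: "(real \<Rightarrow> 'a::real_normed_vector) \<Rightarrow> bool" where
  "immersed c \<longleftrightarrow> c differentiable_on {0..1} \<and> (\<forall>x\<in>{0..1}. dx c x \<noteq> 0)"

(* In what follows the first argument c is the curve; X is a vector field along c. *)

definition ds_integral :: "(real \<Rightarrow> 'a::real_normed_vector) \<Rightarrow> (real \<Rightarrow> real) \<Rightarrow> real" where
  "ds_integral c g = integral {0..1} (\<lambda>x. g x * norm (dx c x))"

definition curve_length :: "(real \<Rightarrow> 'a::real_normed_vector) \<Rightarrow> real" where
  "curve_length c = ds_integral c (\<lambda>x. 1)"

definition ds_deriv :: "(real \<Rightarrow> 'a::real_inner) \<Rightarrow> (real \<Rightarrow> 'a) \<Rightarrow> real \<Rightarrow> 'a" where
  "ds_deriv c X x = (1 / norm (dx c x)) *\<^sub>R dx X x"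

definition tangent :: "(real \<Rightarrow> 'a::real_inner) \<Rightarrow> real \<Rightarrow> 'a" where
  "tangent c = ds_deriv c c"

definition curvature :: "(real \<Rightarrow> 'a::real_inner) \<Rightarrow> real \<Rightarrow> 'a" where
  "curvature c = ds_deriv c (ds_deriv c c)"

definition normal_proj :: "(real \<Rightarrow> 'a::real_inner) \<Rightarrow> (real \<Rightarrow> 'a) \<Rightarrow> real \<Rightarrow> 'a" where
  "normal_proj c X x = X x - inner (X x) (tangent c x) *\<^sub>R tangent c x"

definition nabla_s :: "(real \<Rightarrow> 'a::real_inner) \<Rightarrow> (real \<Rightarrow> 'a) \<Rightarrow> real \<Rightarrow> 'a" where
  "nabla_s c X = normal_proj c (ds_deriv c X)"

definition elastic_energy :: "(real \<Rightarrow> 'a::real_inner) \<Rightarrow> real" where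
  "elastic_energy c = 1/2 * ds_integral c (\<lambda>x. (norm (curvature c x))\<^sup>2)"

definition L2_norm_dx :: "(real \<Rightarrow> 'a::real_normed_vector) \<Rightarrow> real" where
  "L2_norm_dx X = sqrt (integral {0..1} (\<lambda>x. (norm (X x))\<^sup>2))"

definition L2_norm_ds :: "(real \<Rightarrow> 'a::real_inner) \<Rightarrow> (real \<Rightarrow> 'a) \<Rightarrow> real" where
  "L2_norm_ds c X = sqrt (ds_integral c (\<lambda>x. (norm (X x))\<^sup>2))"

definition arc_param :: "(real \<Rightarrow> 'a::real_normed_vector) \<Rightarrow> real \<Rightarrow> real" where
  "arc_param c x = 1 / curve_length c * integral {0..x} (\<lambda>z. norm (dx c z))"

definition const_speed :: "(real \<Rightarrow> 'a::real_normed_vector) \<Rightarrow> real \<Rightarrow> 'a" where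
  "const_speed c x = c (the_inv_into {0..1} (arc_param c) x)"

(* The L2 gradient of the elastic energy. *)
definition elastic_grad :: "(real \<Rightarrow> 'a::real_inner) \<Rightarrow> real \<Rightarrow> 'a" where
  "elastic_grad c x = nabla_s c (nabla_s c (curvature c)) x
     + (1/2 * (norm (curvature c x))\<^sup>2) *\<^sub>R curvature c x"

definition lagrange_mult :: "(real \<Rightarrow> 'a::real_inner) \<Rightarrow> real" where
  "lagrange_mult c =
     ds_integral c (\<lambda>x. inner (elastic_grad c x) (curvature c x))
     / ds_integral c (\<lambda>x. (norm (curvature c x))\<^sup>2)"

(* The tangential velocity theta is not prescribed: it is the tangential part of the velocity,
   so the equation only constrains the normal velocity. *)
definition lp_elastic_flow ::
  "ereal \<Rightarrow> 'a \<Rightarrow> 'a \<Rightarrow> 'a \<Rightarrow> 'a \<Rightarrow> (real \<Rightarrow> 'a) \<Rightarrow> (real \<Rightarrow> real \<Rightarrow> 'a::real_inner) \<Rightarrow> bool" where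
  "lp_elastic_flow T p0 p1 \<tau>0 \<tau>1 f0 f \<longleftrightarrow>
     (\<forall>t\<in>time_dom T. 0 < t \<longrightarrow> (\<forall>x\<in>{0..1}.
        dt T f t x =
          - nabla_s (f t) (nabla_s (f t) (curvature (f t))) x
          - (1/2 * (norm (curvature (f t) x))\<^sup>2) *\<^sub>R curvature (f t) x
          + lagrange_mult (f t) *\<^sub>R curvature (f t) x
          + inner (dt T f t x) (tangent (f t) x) *\<^sub>R tangent (f t) x)) \<and>
     (\<forall>x\<in>{0..1}. f 0 x = f0 x) \<and>
     (\<forall>t\<in>time_dom T. f t 0 = p0 \<and> f t 1 = p1 \<and> tangent (f t) 0 = \<tau>0 \<and> tangent (f t) 1 = \<tau>1)"

end

(* Write V for the velocity of f, L for the length, E for the energy, and K y for the integral of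
   <V, kappa> ds over [0, y]. Differentiating the arc length parameter phi under the integral sign
   and integrating by parts (V vanishes at the ends) gives
     (d/dt f~)(phi y) = normal part of V + (K y - phi y * K 1) tau.
   The coefficient of tau is at most the integral of |<V, kappa>| ds, so Cauchy-Schwarz and the
   substitution x = phi y bound the squared L2 norm by (1/L + 2 E) times that of V, which is better
   than claimed. Along the flow L' = -K 1 = 0 by the choice of the multiplier, and the first variation
   of the energy gives E' = -(integral of |normal part of V|^2 ds), so L is constant and E is at most
   its initial value. *)

theory Submission
  imports Defs
begin

text \<open>The tangential part of V drops out of the reparametrized velocity because integrating
  \<open>inner (dx (V t) x) (\<tau> t x)\<close> by parts over \<open>{0..y}\<close> leaves the
  boundary term \<open>inner (V t y) (\<tau> t y)\<close>: it enters the time derivative of phi, and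
  the chain rule subtracts it from V. The remaining coefficient equals (1 - phi y) times the
  integral over \<open>{0..y}\<close> minus phi y times the integral over \<open>{y..1}\<close>,
  with weights in [0,1]; hence a bound without a factor 2. The gradient of the energy is an exact
  arc length derivative, of the field \<open>W\<close>. This reduces the first variation to
  integrations by parts whose boundary terms vanish because both end points and both end tangents
  are fixed. The obstacle is the boundary: time 0 and the ends of the parameter interval admit only
  one-sided derivatives. Smoothness, symmetry of mixed derivatives and the time derivative of the
  inverse of phi are therefore all developed within \<open>time_dom T \<times> {0..1}\<close>. As
  the flow equation is imposed only for positive times, continuity carries the statements on length
  and energy to time 0.\<close>

section \<open>Smooth families up to the boundary\<close>

lemma Ck_on_SucI:
  assumes "Ck_on k S g1" "Ck_on k S g2"
    and "\<And>z. z \<in> S \<Longrightarrow> (g has_derivative (\<lambda>h. fst h *\<^sub>R g1 z + snd h *\<^sub>R g2 z)) (at z within S)"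
  shows "Ck_on (Suc k) S g"
  unfolding Ck_on.simps using assms by blast

lemma Ck_on_SucE:
  assumes "Ck_on (Suc k) S g"
  obtains g1 g2 where "Ck_on k S g1" "Ck_on k S g2"
    "\<And>z. z \<in> S \<Longrightarrow> (g has_derivative (\<lambda>h. fst h *\<^sub>R g1 z + snd h *\<^sub>R g2 z)) (at z within S)"
  using assms unfolding Ck_on.simps by blast

text \<open>Derivatives within S see only values on S. This later replaces the existential witnesses
  in \<open>Ck_on\<close> by \<open>dt\<close> and \<open>dx\<close>.\<close>

lemma Ck_on_cong:
  assumes "Ck_on k S g" and eq: "\<And>z. z \<in> S \<Longrightarrow> h z = g z"
  shows "Ck_on k S h"
proof (cases k)
  case 0
  with assms show ?thesis by (metis Ck_on.simps(1) continuous_on_cong)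
next
  case (Suc j)
  with assms(1) have "Ck_on (Suc j) S g" by simp
  then obtain g1 g2 where *: "Ck_on j S g1" "Ck_on j S g2"
    and d: "\<And>z. z \<in> S \<Longrightarrow> (g has_derivative (\<lambda>h. fst h *\<^sub>R g1 z + snd h *\<^sub>R g2 z)) (at z within S)"
    by (rule Ck_on_SucE) (rule that)
  have "(h has_derivative (\<lambda>h. fst h *\<^sub>R g1 z + snd h *\<^sub>R g2 z)) (at z within S)" if "z \<in> S" for z
    by (rule has_derivative_transform[OF that _ d[OF that]]) (use eq in auto)
  with * have "Ck_on (Suc j) S h" by (rule Ck_on_SucI)
  with Suc show ?thesis by simp
qed

lemma Ck_on_imp_continuous_on: "Ck_on k S g \<Longrightarrow> continuous_on S g"
proof (cases k)
  case (Suc j)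
  assume "Ck_on k S g"
  with Suc have "Ck_on (Suc j) S g" by simp
  then show ?thesis by (rule Ck_on_SucE) (rule has_derivative_continuous_on)
qed simp

lemma Ck_on_SucD: "Ck_on (Suc k) S g \<Longrightarrow> Ck_on k S g"
proof (induction k arbitrary: g)
  case 0
  then show ?case by (simp only: Ck_on.simps(1) Ck_on_imp_continuous_on)
next
  case (Suc k)
  from Suc.prems show ?case by (rule Ck_on_SucE) (rule Ck_on_SucI[OF Suc.IH Suc.IH])
qed

lemma Ck_on_const: "Ck_on k S (\<lambda>z. c)"
proof (induction k arbitrary: c)
  case (Suc k)
  have "((\<lambda>z. c) has_derivative (\<lambda>h. fst h *\<^sub>R 0 + snd h *\<^sub>R 0)) (at z within S)" for z
    by simp
  with Suc[of 0] Suc[of 0] show ?case by (rule Ck_on_SucI)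
qed simp

lemma Ck_on_add:
  assumes "Ck_on k S g" "Ck_on k S h"
  shows "Ck_on k S (\<lambda>z. g z + h z)"
  using assms
proof (induction k arbitrary: g h)
  case 0
  then show ?case by (auto intro: continuous_intros)
next
  case (Suc k)
  from Suc.prems(1) obtain g1 g2 where g: "Ck_on k S g1" "Ck_on k S g2"
    "\<And>z. z \<in> S \<Longrightarrow> (g has_derivative (\<lambda>h. fst h *\<^sub>R g1 z + snd h *\<^sub>R g2 z)) (at z within S)"
    by (rule Ck_on_SucE) (rule that)
  from Suc.prems(2) obtain h1 h2 where h: "Ck_on k S h1" "Ck_on k S h2"
    "\<And>z. z \<in> S \<Longrightarrow> (h has_derivative (\<lambda>w. fst w *\<^sub>R h1 z + snd w *\<^sub>R h2 z)) (at z within S)"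
    by (rule Ck_on_SucE) (rule that)
  have "((\<lambda>z. g z + h z) has_derivative
      (\<lambda>w. fst w *\<^sub>R (g1 z + h1 z) + snd w *\<^sub>R (g2 z + h2 z))) (at z within S)" if "z \<in> S" for z
    by (rule has_derivative_eq_rhs[OF has_derivative_add[OF g(3) h(3)]])
      (auto simp: that algebra_simps)
  with Suc.IH[OF g(1) h(1)] Suc.IH[OF g(2) h(2)] show ?case by (rule Ck_on_SucI)
qed

text \<open>The product rule pairs a derivative of one factor with the other factor
  undifferentiated, so the induction hypothesis also needs the factors themselves at order k;
  \<open>Ck_on_SucD\<close> provides this.\<close>

lemma Ck_on_bilinear:
  assumes bil: "bounded_bilinear b" and "Ck_on k S g" "Ck_on k S h"
  shows "Ck_on k S (\<lambda>z. b (g z) (h z))"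
  using assms(2,3)
proof (induction k arbitrary: g h)
  case 0
  then show ?case by (auto intro: bounded_bilinear.continuous_on[OF bil])
next
  case (Suc k)
  interpret bounded_bilinear b by fact
  from Suc.prems(1) obtain g1 g2 where g: "Ck_on k S g1" "Ck_on k S g2"
    "\<And>z. z \<in> S \<Longrightarrow> (g has_derivative (\<lambda>h. fst h *\<^sub>R g1 z + snd h *\<^sub>R g2 z)) (at z within S)"
    by (rule Ck_on_SucE) (rule that)
  from Suc.prems(2) obtain h1 h2 where h: "Ck_on k S h1" "Ck_on k S h2"
    "\<And>z. z \<in> S \<Longrightarrow> (h has_derivative (\<lambda>w. fst w *\<^sub>R h1 z + snd w *\<^sub>R h2 z)) (at z within S)"
    by (rule Ck_on_SucE) (rule that)
  have d: "((\<lambda>z. b (g z) (h z)) has_derivative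
      (\<lambda>w. fst w *\<^sub>R (b (g z) (h1 z) + b (g1 z) (h z)) + snd w *\<^sub>R (b (g z) (h2 z) + b (g2 z) (h z))))
      (at z within S)" if "z \<in> S" for z
    by (rule has_derivative_eq_rhs[OF FDERIV[OF g(3) h(3)]])
      (auto simp: that algebra_simps add_left add_right scaleR_left scaleR_right)
  note lower = Suc.prems[THEN Ck_on_SucD]
  have "Ck_on k S (\<lambda>z. b (g z) (h1 z) + b (g1 z) (h z))"
    "Ck_on k S (\<lambda>z. b (g z) (h2 z) + b (g2 z) (h z))"
    by (intro Ck_on_add Suc.IH lower g h)+
  then show ?case using d by (rule Ck_on_SucI)
qed

text \<open>The partial derivatives of 1/g are polynomials in those of g and in 1/g, so order k of
  1/g itself yields order k + 1. They are written as nested products, sign included, to match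
  \<open>Ck_on_bilinear\<close>.\<close>

lemma Ck_on_inverse:
  fixes g :: "real \<times> real \<Rightarrow> real"
  assumes "Ck_on k S g" "\<And>z. z \<in> S \<Longrightarrow> g z \<noteq> 0"
  shows "Ck_on k S (\<lambda>z. inverse (g z))"
  using assms
proof (induction k arbitrary: g)
  case 0
  then show ?case by (auto intro: continuous_intros)
next
  case (Suc k)
  from Suc.prems(1) obtain g1 g2 where g: "Ck_on k S g1" "Ck_on k S g2"
    "\<And>z. z \<in> S \<Longrightarrow> (g has_derivative (\<lambda>h. fst h *\<^sub>R g1 z + snd h *\<^sub>R g2 z)) (at z within S)"
    by (rule Ck_on_SucE) (rule that)
  have d: "((\<lambda>z. inverse (g z)) has_derivative
      (\<lambda>w. fst w *\<^sub>R (-1 * (g1 z * (inverse (g z) * inverse (g z))))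
         + snd w *\<^sub>R (-1 * (g2 z * (inverse (g z) * inverse (g z)))))) (at z within S)" if "z \<in> S" for z
  proof (rule has_derivative_eq_rhs[OF Deriv.has_derivative_inverse[OF Suc.prems(2)[OF that] g(3)[OF that]]], rule ext)
    show "- (inverse (g z) * (fst w *\<^sub>R g1 z + snd w *\<^sub>R g2 z) * inverse (g z)) =
        fst w *\<^sub>R (-1 * (g1 z * (inverse (g z) * inverse (g z))))
         + snd w *\<^sub>R (-1 * (g2 z * (inverse (g z) * inverse (g z))))" for w
      by (simp only: real_scaleR_def) algebra
  qed
  have inv: "Ck_on k S (\<lambda>z. inverse (g z))"
    by (intro Suc.IH Ck_on_SucD[OF Suc.prems(1)] Suc.prems(2))
  have "Ck_on k S (\<lambda>z. -1 * (g1 z * (inverse (g z) * inverse (g z))))"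
    "Ck_on k S (\<lambda>z. -1 * (g2 z * (inverse (g z) * inverse (g z))))"
    by (intro Ck_on_bilinear[OF bounded_bilinear_mult] Ck_on_const inv g)+
  then show ?case using d by (rule Ck_on_SucI)
qed

text \<open>Same bootstrap as for the inverse: the derivatives involve only those of g and the
  inverse of the square root. Norms of nowhere vanishing fields, in particular the speed, are smooth
  for this reason.\<close>

lemma Ck_on_sqrt:
  assumes "Ck_on k S g" "\<And>z. z \<in> S \<Longrightarrow> g z > 0"
  shows "Ck_on k S (\<lambda>z. sqrt (g z))"
  using assms
proof (induction k arbitrary: g)
  case 0
  then show ?case by (auto intro: continuous_intros)
next
  case (Suc k)
  from Suc.prems(1) obtain g1 g2 where g: "Ck_on k S g1" "Ck_on k S g2"
    "\<And>z. z \<in> S \<Longrightarrow> (g has_derivative (\<lambda>h. fst h *\<^sub>R g1 z + snd h *\<^sub>R g2 z)) (at z within S)"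
    by (rule Ck_on_SucE) (rule that)
  have d: "((\<lambda>z. sqrt (g z)) has_derivative
      (\<lambda>w. fst w *\<^sub>R (1/2 * (g1 z * inverse (sqrt (g z))))
         + snd w *\<^sub>R (1/2 * (g2 z * inverse (sqrt (g z)))))) (at z within S)" if "z \<in> S" for z
    by (rule has_derivative_eq_rhs[OF has_derivative_real_sqrt[OF Suc.prems(2)[OF that] g(3)[OF that]]])
      (rule ext, use Suc.prems(2)[OF that] in \<open>simp add: field_simps\<close>)
  have inv: "Ck_on k S (\<lambda>z. inverse (sqrt (g z)))"
  proof (rule Ck_on_inverse)
    show "Ck_on k S (\<lambda>z. sqrt (g z))"
      by (intro Suc.IH Ck_on_SucD[OF Suc.prems(1)] Suc.prems(2))
    show "sqrt (g z) \<noteq> 0" if "z \<in> S" for z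
      using Suc.prems(2)[OF that] by simp
  qed
  have "Ck_on k S (\<lambda>z. 1/2 * (g1 z * inverse (sqrt (g z))))"
    "Ck_on k S (\<lambda>z. 1/2 * (g2 z * inverse (sqrt (g z))))"
    by (intro Ck_on_bilinear[OF bounded_bilinear_mult] Ck_on_const inv g)+
  then show ?case using d by (rule Ck_on_SucI)
qed

section \<open>The time domain and one-sided partial derivatives\<close>

lemma time_domE:
  assumes "t \<in> time_dom T"
  obtains r where "t < r" "{0..r} \<subseteq> time_dom T"
proof -
  have "ereal t < T" using assms by (simp add: time_dom_def)
  then obtain r where r: "ereal t < ereal r" "ereal r < T"
    using ereal_dense2 by blast
  then have "{0..r} \<subseteq> time_dom T"
    by (auto simp: time_dom_def) (meson ereal_less_eq(3) le_less_trans)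
  with r that show ?thesis by auto
qed

lemma convex_time_dom: "convex (time_dom T)"
  unfolding is_interval_convex_1[symmetric] is_interval_1 time_dom_def
proof (intro ballI allI impI, clarsimp)
  fix b x
  assume "ereal b < T" "x \<le> b"
  then show "ereal x < T" by (metis ereal_less_eq(3) le_less_trans)
qed

text \<open>The domain is open on its right side, so t can always be approached from the right, also
  when t = 0. Hence vector derivatives in time are unique.\<close>

lemma at_within_time_dom_nonbot:
  assumes "t \<in> time_dom T"
  shows "at t within time_dom T \<noteq> bot"
proof -
  obtain r where r: "t < r" "{0..r} \<subseteq> time_dom T" using time_domE[OF assms] .
  have "0 \<le> t" using assms by (simp add: time_dom_def)
  then have "{t..r} \<subseteq> time_dom T" using r(2) by auto
  then have "at_right t \<le> at t within time_dom T"
    using at_le[of "{t..r}" "time_dom T" t] r(1) by (simp add: at_within_Icc_at_right)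
  then show ?thesis using trivial_limit_at_right_real by (metis bot.extremum_uniqueI)
qed

lemma dt_eqI:
  assumes "t \<in> time_dom T" "((\<lambda>s. F s x) has_vector_derivative D) (at t within time_dom T)"
  shows "dt T F t x = D"
  unfolding dt_def using vector_derivative_within[OF at_within_time_dom_nonbot] assms by blast

lemma dx_eqI:
  assumes "x \<in> {0..1}" "(X has_vector_derivative D) (at x within {0..1})"
  shows "dx X x = D"
proof -
  have "at x within {0..1} \<noteq> bot"
    using assms(1) by (simp add: trivial_limit_within islimpt_Icc)
  then show ?thesis unfolding dx_def using assms(2) by (rule vector_derivative_within)
qed

lemma has_derivative_partials:
  fixes F :: "real \<Rightarrow> real \<Rightarrow> 'a::real_normed_vector"
  assumes "t \<in> A" "x \<in> B"
    and d: "((\<lambda>(t, x). F t x) has_derivative (\<lambda>h. fst h *\<^sub>R a + snd h *\<^sub>R b)) (at (t, x) within A \<times> B)"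
  shows "((\<lambda>s. F s x) has_vector_derivative a) (at t within A)"
    and "(F t has_vector_derivative b) (at x within B)"
proof -
  have 1: "((\<lambda>s. (s, x)) has_derivative (\<lambda>h. (h, 0))) (at t within A)"
    and 2: "((\<lambda>y. (t, y)) has_derivative (\<lambda>h. (0, h))) (at x within B)"
    by (auto intro!: derivative_eq_intros)
  have "((\<lambda>s. F s x) has_derivative (\<lambda>h. h *\<^sub>R a)) (at t within A)"
    using has_derivative_in_compose[OF 1 has_derivative_subset[OF d]] assms(2)
    by (auto simp: image_subset_iff)
  then show "((\<lambda>s. F s x) has_vector_derivative a) (at t within A)"
    by (simp add: has_vector_derivative_def)
  have "((\<lambda>y. F t y) has_derivative (\<lambda>h. h *\<^sub>R b)) (at x within B)"
    using has_derivative_in_compose[OF 2 has_derivative_subset[OF d]] assms(1)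
    by (auto simp: image_subset_iff)
  then show "(F t has_vector_derivative b) (at x within B)"
    by (simp add: has_vector_derivative_def)
qed

text \<open>The witnesses hidden in \<open>Ck_on\<close> could depend on k. Restriction to
  coordinate slices forces them to be the one-sided partial derivatives, which are unique; only so
  are \<open>dt T F\<close> and \<open>dx (F t)\<close> single functions that inherit every order of
  smoothness.\<close>

lemma Ck_on_partials:
  fixes F :: "real \<Rightarrow> real \<Rightarrow> 'a::real_normed_vector"
  defines "S T \<equiv> time_dom T \<times> {0..1}"
  assumes "Ck_on (Suc k) (S T) (\<lambda>(t, x). F t x)"
  shows "Ck_on k (S T) (\<lambda>(t, x). dt T F t x)" "Ck_on k (S T) (\<lambda>(t, x). dx (F t) x)"
    and "\<And>t x. t \<in> time_dom T \<Longrightarrow> x \<in> {0..1} \<Longrightarrow>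
      ((\<lambda>s. F s x) has_vector_derivative dt T F t x) (at t within time_dom T)"
    and "\<And>t x. t \<in> time_dom T \<Longrightarrow> x \<in> {0..1} \<Longrightarrow>
      (F t has_vector_derivative dx (F t) x) (at x within {0..1})"
    and "\<And>t x. t \<in> time_dom T \<Longrightarrow> x \<in> {0..1} \<Longrightarrow>
      ((\<lambda>(t, x). F t x) has_derivative (\<lambda>h. fst h *\<^sub>R dt T F t x + snd h *\<^sub>R dx (F t) x))
        (at (t, x) within S T)"
proof -
  from assms(2) obtain g1 g2 where g: "Ck_on k (S T) g1" "Ck_on k (S T) g2"
    and d: "\<And>z. z \<in> S T \<Longrightarrow>
      ((\<lambda>(t, x). F t x) has_derivative (\<lambda>h. fst h *\<^sub>R g1 z + snd h *\<^sub>R g2 z)) (at z within S T)"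
    by (rule Ck_on_SucE) (rule that)
  have p1: "((\<lambda>s. F s x) has_vector_derivative g1 (t, x)) (at t within time_dom T)"
    and p2: "(F t has_vector_derivative g2 (t, x)) (at x within {0..1})"
    if "t \<in> time_dom T" "x \<in> {0..1}" for t x
    using has_derivative_partials[OF that d[unfolded S_def]] that by auto
  have e: "dt T F t x = g1 (t, x)" "dx (F t) x = g2 (t, x)"
    if "t \<in> time_dom T" "x \<in> {0..1}" for t x
    using dt_eqI[of t T F x, OF that(1) p1[OF that]] dx_eqI[OF that(2) p2[OF that]] by auto
  show "Ck_on k (S T) (\<lambda>(t, x). dt T F t x)" "Ck_on k (S T) (\<lambda>(t, x). dx (F t) x)"
    by (rule Ck_on_cong[OF g(1)] Ck_on_cong[OF g(2)]; use e in \<open>auto simp: S_def\<close>)+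
  show "((\<lambda>s. F s x) has_vector_derivative dt T F t x) (at t within time_dom T)"
    and "(F t has_vector_derivative dx (F t) x) (at x within {0..1})"
    if "t \<in> time_dom T" "x \<in> {0..1}" for t x
    using p1[OF that] p2[OF that] e[OF that] by auto
  show "((\<lambda>(t, x). F t x) has_derivative (\<lambda>h. fst h *\<^sub>R dt T F t x + snd h *\<^sub>R dx (F t) x))
      (at (t, x) within S T)" if "t \<in> time_dom T" "x \<in> {0..1}" for t x
    unfolding e[OF that] using that by (intro d) (auto simp: S_def)
qed

section \<open>Smooth families: derivatives, closure properties, differentiation under the
  integral\<close>

lemma smooth_family_dt: "smooth_family T F \<Longrightarrow> smooth_family T (dt T F)"
  and smooth_family_dx: "smooth_family T F \<Longrightarrow> smooth_family T (\<lambda>t. dx (F t))"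
  using Ck_on_partials(1,2) unfolding smooth_family_def by blast+

lemma smooth_family_has_derivative:
  assumes "smooth_family T F" "t \<in> time_dom T" "x \<in> {0..1}"
  shows "((\<lambda>(t, x). F t x) has_derivative (\<lambda>h. fst h *\<^sub>R dt T F t x + snd h *\<^sub>R dx (F t) x))
    (at (t, x) within time_dom T \<times> {0..1})"
  using Ck_on_partials(5) assms unfolding smooth_family_def by blast

lemma smooth_family_has_dt:
  assumes "smooth_family T F" "t \<in> time_dom T" "x \<in> {0..1}"
  shows "((\<lambda>s. F s x) has_vector_derivative dt T F t x) (at t within time_dom T)"
  using Ck_on_partials(3) assms unfolding smooth_family_def by blast

lemma smooth_family_has_dx:
  assumes "smooth_family T F" "t \<in> time_dom T" "x \<in> {0..1}"
  shows "(F t has_vector_derivative dx (F t) x) (at x within {0..1})"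
  using Ck_on_partials(4) assms unfolding smooth_family_def by blast

lemma smooth_family_continuous_on:
  "smooth_family T F \<Longrightarrow> continuous_on (time_dom T \<times> {0..1}) (\<lambda>(t, x). F t x)"
  unfolding smooth_family_def using Ck_on_imp_continuous_on by blast

lemma smooth_family_continuous_on_space:
  assumes "smooth_family T F" "t \<in> time_dom T" "0 \<le> a" "b \<le> 1"
  shows "continuous_on {a..b} (F t)"
proof -
  have "continuous_on {a..b} (\<lambda>x. (\<lambda>(t, x). F t x) (t, x))"
    by (rule continuous_on_compose2[OF smooth_family_continuous_on[OF assms(1)]])
      (use assms in \<open>auto intro!: continuous_intros\<close>)
  then show ?thesis by simp
qed

lemma smooth_family_const: "smooth_family T (\<lambda>t x. c)"
  unfolding smooth_family_def case_prod_unfold by (intro allI Ck_on_const)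

lemma smooth_family_add:
  assumes "smooth_family T F" "smooth_family T G"
  shows "smooth_family T (\<lambda>t x. F t x + G t x)"
  using assms unfolding smooth_family_def case_prod_unfold by (intro allI Ck_on_add) auto

lemma smooth_family_bilinear:
  assumes "bounded_bilinear b" "smooth_family T F" "smooth_family T G"
  shows "smooth_family T (\<lambda>t x. b (F t x) (G t x))"
  using assms(2,3) unfolding smooth_family_def case_prod_unfold
  by (intro allI Ck_on_bilinear[OF assms(1)]) auto

lemmas smooth_family_scaleR = smooth_family_bilinear[OF bounded_bilinear_scaleR]
  and smooth_family_mult = smooth_family_bilinear[OF bounded_bilinear_mult]
  and smooth_family_inner = smooth_family_bilinear[OF bounded_bilinear_inner]

lemma smooth_family_diff:
  assumes "smooth_family T F" "smooth_family T G"
  shows "smooth_family T (\<lambda>t x. F t x - G t x)"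
proof -
  have "smooth_family T (\<lambda>t x. F t x + (-1) *\<^sub>R G t x)"
    by (intro smooth_family_add smooth_family_scaleR smooth_family_const assms)
  then show ?thesis by simp
qed

lemma smooth_family_inverse:
  fixes F :: "real \<Rightarrow> real \<Rightarrow> real"
  assumes "smooth_family T F" "\<And>t x. t \<in> time_dom T \<Longrightarrow> x \<in> {0..1} \<Longrightarrow> F t x \<noteq> 0"
  shows "smooth_family T (\<lambda>t x. inverse (F t x))"
  unfolding smooth_family_def
proof
  fix k
  have "Ck_on k (time_dom T \<times> {0..1}) (\<lambda>z. inverse (case z of (t, x) \<Rightarrow> F t x))"
    by (rule Ck_on_inverse) (use assms in \<open>auto simp: smooth_family_def\<close>)
  then show "Ck_on k (time_dom T \<times> {0..1}) (\<lambda>(t, x). inverse (F t x))"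
    by (simp add: case_prod_unfold)
qed

lemma smooth_family_norm:
  fixes F :: "real \<Rightarrow> real \<Rightarrow> 'a::real_inner"
  assumes "smooth_family T F" "\<And>t x. t \<in> time_dom T \<Longrightarrow> x \<in> {0..1} \<Longrightarrow> F t x \<noteq> 0"
  shows "smooth_family T (\<lambda>t x. norm (F t x))"
  unfolding smooth_family_def
proof
  fix k
  have "Ck_on k (time_dom T \<times> {0..1}) (\<lambda>z. sqrt (case z of (t, x) \<Rightarrow> inner (F t x) (F t x)))"
    using smooth_family_inner[OF assms(1) assms(1)]
    by (intro Ck_on_sqrt) (use assms in \<open>auto simp: smooth_family_def\<close>)
  then show "Ck_on k (time_dom T \<times> {0..1}) (\<lambda>(t, x). norm (F t x))"
    by (simp add: case_prod_unfold norm_eq_sqrt_inner)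
qed

lemma leibniz_smooth_family:
  fixes F :: "real \<Rightarrow> real \<Rightarrow> 'a::banach"
  assumes F: "smooth_family T F" and t: "t \<in> time_dom T" and "0 \<le> a" "b \<le> 1"
  shows "((\<lambda>s. integral {a..b} (F s)) has_vector_derivative integral {a..b} (dt T F t))
    (at t within time_dom T)"
proof -
  have "continuous_on (time_dom T \<times> cbox a b) (\<lambda>(t, x). dt T F t x)"
    by (rule continuous_on_subset[OF smooth_family_continuous_on[OF smooth_family_dt[OF F]]])
      (use assms in auto)
  then show ?thesis
    using leibniz_rule_vector_derivative[of "time_dom T" a b F "dt T F" t]
    using t assms smooth_family_has_dt[OF F]
    by (auto simp: convex_time_dom intro!: integrable_continuous_interval smooth_family_continuous_on_space)
qed

text \<open>Differentiating \<open>F t x = F t 0 + integral {0..x} (dx (F t))\<close> in \<open>t\<close> by the Leibniz rule and then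
  in \<open>x\<close> gives symmetry at boundary points as well.\<close>

lemma smooth_family_dt_dx:
  fixes F :: "real \<Rightarrow> real \<Rightarrow> 'a::banach"
  assumes F: "smooth_family T F" and t: "t \<in> time_dom T" and x: "x \<in> {0..1}"
  shows "dt T (\<lambda>t. dx (F t)) t x = dx (dt T F t) x"
proof -
  have Fx: "smooth_family T (\<lambda>t. dx (F t))" by (rule smooth_family_dx[OF F])
  note cont = smooth_family_continuous_on_space
  have eq: "dt T F t y = integral {0..y} (dt T (\<lambda>t. dx (F t)) t) + dt T F t 0" if y: "y \<in> {0..1}" for y
  proof -
    have ftc: "integral {0..y} (dx (F s)) + F s 0 = F s y" if "s \<in> time_dom T" for s
    proof -
      have "(dx (F s) has_integral F s y - F s 0) {0..y}"
        by (rule fundamental_theorem_of_calculus)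
          (use y smooth_family_has_dx[OF F that] in \<open>auto intro: has_vector_derivative_within_subset[where S = "{0..1}"]\<close>)
      then show ?thesis by (simp add: integral_unique)
    qed
    have "((\<lambda>s. integral {0..y} (dx (F s)) + F s 0) has_vector_derivative
        integral {0..y} (dt T (\<lambda>t. dx (F t)) t) + dt T F t 0) (at t within time_dom T)"
      using y by (intro has_vector_derivative_add leibniz_smooth_family Fx t smooth_family_has_dt F) auto
    then have "((\<lambda>s. F s y) has_vector_derivative
        integral {0..y} (dt T (\<lambda>t. dx (F t)) t) + dt T F t 0) (at t within time_dom T)"
      by (rule has_vector_derivative_transform[OF t, rotated]) (use ftc in auto)
    then show ?thesis by (rule dt_eqI[OF t])
  qed
  have "((\<lambda>y. integral {0..y} (dt T (\<lambda>t. dx (F t)) t) + dt T F t 0) has_vector_derivative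
      dt T (\<lambda>t. dx (F t)) t x) (at x within {0..1})"
    using has_vector_derivative_add[OF integral_has_vector_derivative[OF
        cont[OF smooth_family_dt[OF Fx] t order_refl order_refl] x] has_vector_derivative_const]
    by simp
  then have "(dt T F t has_vector_derivative dt T (\<lambda>t. dx (F t)) t x) (at x within {0..1})"
    by (rule has_vector_derivative_transform[OF x, rotated]) (rule eq)
  then show ?thesis by (simp add: dx_eqI[OF x])
qed

section \<open>Calculus on the unit interval\<close>

lemma integral_Cauchy_Schwarz:
  fixes p q :: "real \<Rightarrow> real"
  assumes "continuous_on {a..b} p" "continuous_on {a..b} q"
  shows "(integral {a..b} (\<lambda>x. p x * q x))\<^sup>2
    \<le> integral {a..b} (\<lambda>x. (p x)\<^sup>2) * integral {a..b} (\<lambda>x. (q x)\<^sup>2)"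
proof -
  define P Q C where "P = integral {a..b} (\<lambda>x. (p x)\<^sup>2)" and "Q = integral {a..b} (\<lambda>x. (q x)\<^sup>2)"
    and "C = integral {a..b} (\<lambda>x. p x * q x)"
  \<comment> \<open>Discriminant argument: this is the integral of the square of p + c q.\<close>
  have quad: "0 \<le> P + 2 * c * C + c\<^sup>2 * Q" for c
  proof -
    have "((\<lambda>x. (p x)\<^sup>2 + 2 * c * (p x * q x) + c\<^sup>2 * (q x)\<^sup>2) has_integral P + 2 * c * C + c\<^sup>2 * Q) {a..b}"
      unfolding P_def Q_def C_def
      by (intro has_integral_add has_integral_mult_right integrable_integral
          integrable_continuous_interval continuous_intros assms)
    moreover have "(p x + c * q x)\<^sup>2 = (p x)\<^sup>2 + 2 * c * (p x * q x) + c\<^sup>2 * (q x)\<^sup>2" for x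
      by (simp add: power2_sum power_mult_distrib)
    ultimately have "((\<lambda>x. (p x + c * q x)\<^sup>2) has_integral P + 2 * c * C + c\<^sup>2 * Q) {a..b}"
      by simp
    then show ?thesis by (rule has_integral_nonneg) simp
  qed
  have "0 \<le> Q" unfolding Q_def
    by (intro integral_nonneg integrable_continuous_interval continuous_intros assms) auto
  have "C\<^sup>2 \<le> P * Q"
  proof (cases "Q = 0")
    case True
    have "C = 0"
    proof (rule ccontr)
      assume "C \<noteq> 0"
      \<comment> \<open>With \<open>Q = 0\<close> the quadratic is affine in c, and this c gives it
        the value -1.\<close>
      with True quad[of "-(P + 1) / (2 * C)"] show False by (simp add: field_simps)
    qed
    with True show ?thesis by simp
  next
    case False
    with \<open>0 \<le> Q\<close> have "Q > 0" by simp
    \<comment> \<open>The minimizer of the quadratic, where its value is P - C^2 / Q.\<close>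
    with quad[of "- C / Q"] show ?thesis by (simp add: field_simps power2_eq_square)
  qed
  then show ?thesis by (simp add: P_def Q_def C_def)
qed

lemma has_integral_derivative_unit_interval:
  fixes G G' :: "real \<Rightarrow> 'a::banach"
  assumes "\<And>x. x \<in> {0..1} \<Longrightarrow> (G has_vector_derivative G' x) (at x within {0..1})" "y \<in> {0..1}"
  shows "(G' has_integral G y - G 0) {0..y}"
  by (rule fundamental_theorem_of_calculus)
    (use assms in \<open>auto intro: has_vector_derivative_within_subset[where S = "{0..1}"]\<close>)

lemma mvt_unit_interval:
  fixes g g' :: "real \<Rightarrow> real"
  assumes deriv: "\<And>z. z \<in> {0..1} \<Longrightarrow> (g has_real_derivative g' z) (at z within {0..1})"
    and "a < b" "0 \<le> a" "b \<le> 1"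
  shows "\<exists>\<xi>\<in>{a<..<b}. g b - g a = g' \<xi> * (b - a)"
proof (rule mvt_simple[OF \<open>a < b\<close>, of g "\<lambda>z h. g' z * h"])
  fix z assume "a \<le> z" "z \<le> b"
  then show "(g has_derivative (*) (g' z)) (at z within {a..b})"
    using deriv[of z] assms(2-) unfolding has_field_derivative_def
    by (auto intro: has_derivative_subset[where s = "{0..1}"])
qed

text \<open>The usual implicit function theorem does not cover one-sided derivatives in \<open>s\<close>, nor values
  of \<open>x\<close> at the ends of the interval.\<close>

lemma implicit_inverse_has_derivative:
  fixes \<phi> w :: "real \<Rightarrow> real \<Rightarrow> real" and \<psi> :: "real \<Rightarrow> real"
  assumes t: "t \<in> time_dom T"
    and dphi: "\<And>s z. s \<in> time_dom T \<Longrightarrow> z \<in> {0..1} \<Longrightarrow>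
      (\<phi> s has_real_derivative w s z) (at z within {0..1})"
    and w: "continuous_on (time_dom T \<times> {0..1}) (\<lambda>(s, z). w s z)"
    and w_pos: "\<And>s z. s \<in> time_dom T \<Longrightarrow> z \<in> {0..1} \<Longrightarrow> w s z > 0"
    and psi: "\<And>s. s \<in> time_dom T \<Longrightarrow> \<psi> s \<in> {0..1} \<and> \<phi> s (\<psi> s) = x"
    and D: "((\<lambda>s. \<phi> s (\<psi> t)) has_real_derivative D) (at t within time_dom T)"
  shows "(\<psi> has_real_derivative - D / w t (\<psi> t)) (at t within time_dom T)"
proof -
  define y where "y = \<psi> t"
  have y: "y \<in> {0..1}" "\<phi> t y = x" using psi[OF t] by (auto simp: y_def)
  \<comment> \<open>Mean value theorem in space, using \<open>\<phi> s (\<psi> s) = x\<close>. It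
    expresses the difference quotient of \<open>\<psi>\<close> through that of \<open>\<phi>\<close>
    at the fixed point y and the weight at an intermediate point; what remains is to show that this
    point tends to y.\<close>
  have "\<exists>\<xi>\<in>{0..1}. \<bar>\<xi> - y\<bar> \<le> \<bar>\<psi> s - y\<bar> \<and> x - \<phi> s y = w s \<xi> * (\<psi> s - y)"
    if s: "s \<in> time_dom T" for s
  proof -
    note mvt = mvt_unit_interval[OF dphi[OF s]]
    have z: "\<psi> s \<in> {0..1}" "\<phi> s (\<psi> s) = x" using psi[OF s] by auto
    consider "\<psi> s = y" | "\<psi> s < y" | "y < \<psi> s" by linarith
    then show ?thesis
    proof cases
      case 1
      then show ?thesis using y z by auto
    next
      case 2
      with mvt[of "\<psi> s" y] y z obtain \<xi> where "\<xi> \<in> {\<psi> s<..<y}" "\<phi> s y - x = w s \<xi> * (y - \<psi> s)"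
        by auto
      then show ?thesis using y z by (intro bexI[of _ \<xi>]) (auto simp: algebra_simps)
    next
      case 3
      with mvt[of y "\<psi> s"] y z obtain \<xi> where "\<xi> \<in> {y<..<\<psi> s}" "x - \<phi> s y = w s \<xi> * (\<psi> s - y)"
        by auto
      then show ?thesis using y z by (intro bexI[of _ \<xi>]) (auto simp: algebra_simps)
    qed
  qed
  then obtain \<xi> where \<xi>: "\<And>s. s \<in> time_dom T \<Longrightarrow> \<xi> s \<in> {0..1}"
    "\<And>s. s \<in> time_dom T \<Longrightarrow> \<bar>\<xi> s - y\<bar> \<le> \<bar>\<psi> s - y\<bar>"
    "\<And>s. s \<in> time_dom T \<Longrightarrow> x - \<phi> s y = w s (\<xi> s) * (\<psi> s - y)"
    by metis
  let ?F = "at t within time_dom T"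
  have in_dom: "\<forall>\<^sub>F s in ?F. s \<in> time_dom T" by (simp add: eventually_at_filter)
  obtain r where r: "t < r" "{0..r} \<subseteq> time_dom T" using time_domE[OF t] .
  have "0 \<le> t" using t by (simp add: time_dom_def)
  \<comment> \<open>Continuity of \<open>\<psi>\<close> at t must come before differentiability. A
    lower bound of the weight that is uniform on a compact time interval gives it: the distance from
    \<open>\<psi> s\<close> to y is at most that from \<open>\<phi> s y\<close> to x, divided by
    m.\<close>
  obtain m where m: "m > 0" "\<And>s z. s \<in> {0..r} \<Longrightarrow> z \<in> {0..1} \<Longrightarrow> m \<le> w s z"
  proof -
    have "\<exists>q\<in>{0..r} \<times> {0..1}. \<forall>q'\<in>{0..r} \<times> {0..1}. (\<lambda>(s, z). w s z) q \<le> (\<lambda>(s, z). w s z) q'"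
      by (rule continuous_attains_inf)
        (use r \<open>0 \<le> t\<close> in \<open>auto intro!: compact_Times intro: continuous_on_subset[OF w]\<close>)
    then obtain s0 z0 where "s0 \<in> {0..r}" "z0 \<in> {0..1}"
      "\<And>s z. s \<in> {0..r} \<Longrightarrow> z \<in> {0..1} \<Longrightarrow> w s0 z0 \<le> w s z" by auto
    with that[of "w s0 z0"] w_pos[of s0 z0] r show thesis by auto
  qed
  have "\<forall>\<^sub>F s in ?F. s < r"
    using r(1) by (intro order_tendstoD(2)[OF tendsto_ident_at])
  with in_dom have near: "\<forall>\<^sub>F s in ?F. s \<in> time_dom T \<and> s \<in> {0..r}"
    by eventually_elim (auto simp: time_dom_def)
  have "((\<lambda>s. \<phi> s y) \<longlongrightarrow> \<phi> t y) ?F"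
    using DERIV_continuous[OF D] by (simp add: continuous_within y_def)
  then have "((\<lambda>s. \<bar>x - \<phi> s y\<bar> / m) \<longlongrightarrow> \<bar>x - \<phi> t y\<bar> / m) ?F"
    using m(1) by (intro tendsto_intros) auto
  then have lim0: "((\<lambda>s. \<bar>x - \<phi> s y\<bar> / m) \<longlongrightarrow> 0) ?F" by (simp add: y)
  have "((\<lambda>s. \<xi> s - y) \<longlongrightarrow> 0) ?F"
  proof (rule Lim_null_comparison[OF _ lim0])
    show "\<forall>\<^sub>F s in ?F. norm (\<xi> s - y) \<le> \<bar>x - \<phi> s y\<bar> / m"
      using near
    proof eventually_elim
      case (elim s)
      have "m * \<bar>\<psi> s - y\<bar> \<le> w s (\<xi> s) * \<bar>\<psi> s - y\<bar>"
        using m(2) elim \<xi>(1) by (intro mult_right_mono) auto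
      also have "\<dots> = \<bar>x - \<phi> s y\<bar>"
        using \<xi>(1,3) elim w_pos[of s "\<xi> s"] by (simp add: abs_mult)
      finally have "\<bar>\<psi> s - y\<bar> \<le> \<bar>x - \<phi> s y\<bar> / m" using m(1) by (simp add: field_simps)
      then show ?case using \<xi>(2)[of s] elim by simp
    qed
  qed
  then have "(\<xi> \<longlongrightarrow> y) ?F" by (simp add: LIM_zero_iff)
  then have "((\<lambda>s. (s, \<xi> s)) \<longlongrightarrow> (t, y)) ?F" by (intro tendsto_Pair tendsto_ident_at)
  then have "((\<lambda>s. (\<lambda>(s, z). w s z) (s, \<xi> s)) \<longlongrightarrow> (\<lambda>(s, z). w s z) (t, y)) ?F"
    by (rule continuous_on_tendsto_compose[OF w])
      (use t y \<xi>(1) in_dom in \<open>auto elim!: eventually_mono\<close>)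
  then have w_lim: "((\<lambda>s. w s (\<xi> s)) \<longlongrightarrow> w t y) ?F" by simp
  have "((\<lambda>s. - ((\<phi> s y - \<phi> t y) / (s - t)) / w s (\<xi> s)) \<longlongrightarrow> - D / w t y) ?F"
    using D w_lim w_pos[OF t y(1)]
    by (intro tendsto_intros) (auto simp: has_field_derivative_iff y_def)
  moreover have "\<forall>\<^sub>F s in ?F. - ((\<phi> s y - \<phi> t y) / (s - t)) / w s (\<xi> s) = (\<psi> s - \<psi> t) / (s - t)"
    using in_dom
  proof eventually_elim
    case (elim s)
    have "w s (\<xi> s) \<noteq> 0" using w_pos[OF elim \<xi>(1)[OF elim]] by simp
    moreover have "- (\<phi> s y - \<phi> t y) = w s (\<xi> s) * (\<psi> s - y)" using \<xi>(3)[OF elim] y by simp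
    ultimately have "- (\<phi> s y - \<phi> t y) / w s (\<xi> s) = \<psi> s - \<psi> t" by (simp add: y_def)
    then show ?case by (metis divide_divide_eq_left minus_divide_left mult.commute)
  qed
  ultimately have "((\<lambda>s. (\<psi> s - \<psi> t) / (s - t)) \<longlongrightarrow> - D / w t y) ?F"
    using tendsto_cong by fast
  then show ?thesis by (simp add: has_field_derivative_iff y_def)
qed

section \<open>Geometry of immersed families\<close>

locale immersed_family =
  fixes T :: ereal and f :: "real \<Rightarrow> real \<Rightarrow> 'a::euclidean_space"
  assumes smooth: "smooth_family T f"
    and regular: "\<And>t x. t \<in> time_dom T \<Longrightarrow> x \<in> {0..1} \<Longrightarrow> dx (f t) x \<noteq> 0"
begin

abbreviation v :: "real \<Rightarrow> real \<Rightarrow> real" where "v t x \<equiv> norm (dx (f t) x)"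
abbreviation \<tau> :: "real \<Rightarrow> real \<Rightarrow> 'a" where "\<tau> t \<equiv> tangent (f t)"
abbreviation \<kappa> :: "real \<Rightarrow> real \<Rightarrow> 'a" where "\<kappa> t \<equiv> curvature (f t)"
abbreviation V :: "real \<Rightarrow> real \<Rightarrow> 'a" where "V \<equiv> dt T f"

lemma speed_pos: "t \<in> time_dom T \<Longrightarrow> x \<in> {0..1} \<Longrightarrow> v t x > 0"
  using regular by simp

lemma smooth_speed: "smooth_family T v"
  by (intro smooth_family_norm smooth_family_dx smooth regular)

lemma smooth_ds_deriv:
  assumes "smooth_family T X"
  shows "smooth_family T (\<lambda>t. ds_deriv (f t) (X t))"
proof -
  have "smooth_family T (\<lambda>t x. inverse (v t x) *\<^sub>R dx (X t) x)"
    using assms regular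
    by (intro smooth_family_scaleR smooth_family_inverse smooth_speed smooth_family_dx) auto
  then show ?thesis by (simp add: ds_deriv_def[abs_def] divide_inverse)
qed

lemma smooth_tangent: "smooth_family T \<tau>"
  unfolding tangent_def by (intro smooth_ds_deriv smooth)

lemma smooth_curvature: "smooth_family T \<kappa>"
  unfolding curvature_def by (intro smooth_ds_deriv smooth)

lemma smooth_nabla_s: "smooth_family T X \<Longrightarrow> smooth_family T (\<lambda>t. nabla_s (f t) (X t))"
  unfolding nabla_s_def normal_proj_def[abs_def]
  by (intro smooth_family_diff smooth_family_scaleR smooth_family_inner smooth_tangent smooth_ds_deriv)

lemma smooth_velocity: "smooth_family T V"
  by (rule smooth_family_dt[OF smooth])

lemma dx_eq_ds_deriv:
  assumes "t \<in> time_dom T" "x \<in> {0..1}"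
  shows "dx X x = v t x *\<^sub>R ds_deriv (f t) X x"
  using regular[OF assms] by (simp add: ds_deriv_def)

lemma dx_tangent:
  assumes "t \<in> time_dom T" "x \<in> {0..1}"
  shows "dx (\<tau> t) x = v t x *\<^sub>R \<kappa> t x"
  unfolding curvature_def tangent_def by (rule dx_eq_ds_deriv[OF assms])

lemma has_dx_inner:
  assumes "smooth_family T X" "smooth_family T Y" "t \<in> time_dom T" "x \<in> {0..1}"
  shows "((\<lambda>x. inner (X t x) (Y t x)) has_vector_derivative
    inner (X t x) (dx (Y t) x) + inner (dx (X t) x) (Y t x)) (at x within {0..1})"
  by (rule bounded_bilinear.has_vector_derivative[OF bounded_bilinear_inner];
      rule smooth_family_has_dx[OF _ assms(3,4)]; rule assms)

lemma has_dt_inner: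
  assumes "smooth_family T X" "smooth_family T Y" "t \<in> time_dom T" "x \<in> {0..1}"
  shows "((\<lambda>s. inner (X s x) (Y s x)) has_vector_derivative
    inner (X t x) (dt T Y t x) + inner (dt T X t x) (Y t x)) (at t within time_dom T)"
  by (rule bounded_bilinear.has_vector_derivative[OF bounded_bilinear_inner];
      rule smooth_family_has_dt[OF _ assms(3,4)]; rule assms)

lemma norm_tangent: "t \<in> time_dom T \<Longrightarrow> x \<in> {0..1} \<Longrightarrow> norm (\<tau> t x) = 1"
  using regular by (simp add: tangent_def ds_deriv_def)

lemma inner_tangent_self: "t \<in> time_dom T \<Longrightarrow> x \<in> {0..1} \<Longrightarrow> inner (\<tau> t x) (\<tau> t x) = 1"
  using norm_tangent by (simp add: dot_square_norm)

text \<open>Differentiate \<open>inner (\<tau> t x) (\<tau> t x) = 1\<close> in x.\<close>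

lemma inner_curvature_tangent:
  assumes t: "t \<in> time_dom T" and x: "x \<in> {0..1}"
  shows "inner (\<kappa> t x) (\<tau> t x) = 0"
proof -
  have "((\<lambda>x. 1) has_vector_derivative
      inner (\<tau> t x) (dx (\<tau> t) x) + inner (dx (\<tau> t) x) (\<tau> t x)) (at x within {0..1})"
    by (rule has_vector_derivative_transform[OF x _ has_dx_inner[OF smooth_tangent smooth_tangent t x]])
      (simp add: inner_tangent_self[OF t])
  from dx_eqI[OF x this] dx_eqI[OF x has_vector_derivative_const[of "1::real"]]
  have "inner (dx (\<tau> t) x) (\<tau> t x) = 0" by (simp add: inner_commute)
  with dx_tangent[OF assms] speed_pos[OF assms] show ?thesis by simp
qed

text \<open>The square of the speed is differentiated twice, as an inner product and as a product of
  the smooth function \<open>v\<close> with itself; comparing the results avoids differentiating the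
  norm. Symmetry of mixed derivatives then brings in V.\<close>

lemma dt_speed:
  assumes t: "t \<in> time_dom T" and x: "x \<in> {0..1}"
  shows "dt T v t x = inner (dx (V t) x) (\<tau> t x)"
proof -
  let ?X = "\<lambda>t. dx (f t)"
  note deriv_eqI = dt_eqI[of t T "\<lambda>s x. v s x * v s x" x, OF t]
  have 1: "((\<lambda>s. v s x * v s x) has_vector_derivative
      inner (?X t x) (dt T ?X t x) + inner (dt T ?X t x) (?X t x)) (at t within time_dom T)"
    using has_dt_inner[OF smooth_family_dx smooth_family_dx t x, OF smooth smooth]
    by (simp add: dot_square_norm power2_eq_square)
  have 2: "((\<lambda>s. v s x * v s x) has_vector_derivative
      v t x * dt T v t x + dt T v t x * v t x) (at t within time_dom T)"
    by (intro bounded_bilinear.has_vector_derivative[OF bounded_bilinear_mult]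
        smooth_family_has_dt smooth_speed t x)
  from deriv_eqI[OF 1] deriv_eqI[OF 2]
  have "v t x * dt T v t x = inner (dt T ?X t x) (?X t x)" by (simp add: inner_commute)
  then show ?thesis
    using regular[OF assms] unfolding smooth_family_dt_dx[OF smooth t x] tangent_def ds_deriv_def inner_scaleR_right
    by (simp add: field_simps)
qed

text \<open>Differentiate \<open>dx (f t) x = v t x *\<^sub>R \<tau> t x\<close> in time. By
  \<open>dt_speed\<close> the term with the derivative of the speed is the tangential part of
  \<open>dx (V t) x\<close>, so the normal part is left.\<close>

lemma dt_tangent:
  assumes t: "t \<in> time_dom T" and x: "x \<in> {0..1}"
  shows "v t x *\<^sub>R dt T \<tau> t x = normal_proj (f t) (dx (V t)) x"
proof -
  have "((\<lambda>s. v s x *\<^sub>R \<tau> s x) has_vector_derivative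
      v t x *\<^sub>R dt T \<tau> t x + dt T v t x *\<^sub>R \<tau> t x) (at t within time_dom T)"
    by (intro bounded_bilinear.has_vector_derivative[OF bounded_bilinear_scaleR]
        smooth_family_has_dt smooth_speed smooth_tangent t x)
  then have "((\<lambda>s. dx (f s) x) has_vector_derivative
      v t x *\<^sub>R dt T \<tau> t x + dt T v t x *\<^sub>R \<tau> t x) (at t within time_dom T)"
    by (rule has_vector_derivative_transform[OF t, rotated])
      (unfold tangent_def, rule dx_eq_ds_deriv[OF _ x])
  from dt_eqI[of t T "\<lambda>t. dx (f t)" x, OF t this] smooth_family_dt_dx[OF smooth t x] show ?thesis
    by (simp add: dt_speed[OF assms] normal_proj_def eq_diff_eq)
qed

lemma smooth_velocity_curvature: "smooth_family T (\<lambda>t x. inner (V t x) (\<kappa> t x) * v t x)"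
  by (intro smooth_family_mult smooth_family_inner smooth_velocity smooth_curvature smooth_speed)

text \<open>Integration by parts moves the space derivative in \<open>dt_speed\<close> from V to the
  tangent, which produces the curvature. The boundary term at y is kept: for y = 1 it vanishes on
  pinned curves, and for general y it cancels the tangential velocity later.\<close>

lemma length_variation:
  assumes t: "t \<in> time_dom T" and y: "y \<in> {0..1}" and V0: "V t 0 = 0"
  shows "((\<lambda>s. integral {0..y} (v s)) has_real_derivative
    inner (V t y) (\<tau> t y) - integral {0..y} (\<lambda>x. inner (V t x) (\<kappa> t x) * v t x)) (at t within time_dom T)"
proof -
  have "((\<lambda>x. inner (V t x) (dx (\<tau> t) x) + inner (dx (V t) x) (\<tau> t x)) has_integral
      inner (V t y) (\<tau> t y)) {0..y}"
    using has_integral_derivative_unit_interval[OF has_dx_inner[OF smooth_velocity smooth_tangent t] y] V0 by simp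
  moreover have "inner (V t x) (dx (\<tau> t) x) + inner (dx (V t) x) (\<tau> t x)
      = inner (V t x) (\<kappa> t x) * v t x + dt T v t x" if "x \<in> {0..y}" for x
    using that y dx_tangent[OF t] dt_speed[OF t] by simp
  ultimately have "((\<lambda>x. inner (V t x) (\<kappa> t x) * v t x + dt T v t x) has_integral
      inner (V t y) (\<tau> t y)) {0..y}"
    by (rule has_integral_eq[rotated])
  moreover have int: "(\<lambda>x. inner (V t x) (\<kappa> t x) * v t x) integrable_on {0..y}"
    using y by (intro integrable_continuous_interval
        smooth_family_continuous_on_space[OF smooth_velocity_curvature t]) auto
  ultimately have "integral {0..y} (dt T v t) =
      inner (V t y) (\<tau> t y) - integral {0..y} (\<lambda>x. inner (V t x) (\<kappa> t x) * v t x)"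
    using has_integral_diff[OF _ integrable_integral[OF int]] by (fastforce intro: integral_unique)
  with leibniz_smooth_family[OF smooth_speed t, of 0 y] y show ?thesis
    by (simp add: has_real_derivative_iff_has_vector_derivative)
qed

end

section \<open>The constant speed reparametrization\<close>

lemma curve_length_eq: "curve_length c = integral {0..1} (\<lambda>x. norm (dx c x))"
  by (simp add: curve_length_def ds_integral_def)

locale pinned_family = immersed_family T f
  for T :: ereal and f :: "real \<Rightarrow> real \<Rightarrow> 'a::euclidean_space" +
  fixes p0 p1 :: 'a
  assumes endpoints: "\<And>t. t \<in> time_dom T \<Longrightarrow> f t 0 = p0 \<and> f t 1 = p1"
    and length_pos: "\<And>t. t \<in> time_dom T \<Longrightarrow> curve_length (f t) > 0"
begin

abbreviation L :: "real \<Rightarrow> real" where "L t \<equiv> curve_length (f t)"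
abbreviation \<phi> :: "real \<Rightarrow> real \<Rightarrow> real" where "\<phi> t \<equiv> arc_param (f t)"
abbreviation \<psi> :: "real \<Rightarrow> real \<Rightarrow> real" where "\<psi> t \<equiv> the_inv_into {0..1} (\<phi> t)"
abbreviation K :: "real \<Rightarrow> real \<Rightarrow> real" where
  "K t y \<equiv> integral {0..y} (\<lambda>x. inner (V t x) (\<kappa> t x) * v t x)"

lemma velocity_endpoints:
  assumes t: "t \<in> time_dom T"
  shows "V t 0 = 0" "V t 1 = 0"
proof -
  have "((\<lambda>s. f s y) has_vector_derivative 0) (at t within time_dom T)" if "y = 0 \<or> y = 1" for y
    by (rule has_vector_derivative_transform[OF t _ has_vector_derivative_const[of "f t y"]])
      (use that endpoints t in auto)
  then show "V t 0 = 0" "V t 1 = 0" by (auto intro: dt_eqI[OF t])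
qed

lemma speed_continuous_on: "t \<in> time_dom T \<Longrightarrow> 0 \<le> a \<Longrightarrow> b \<le> 1 \<Longrightarrow> continuous_on {a..b} (v t)"
  by (rule smooth_family_continuous_on_space[OF smooth_speed])

lemma length_has_derivative:
  assumes t: "t \<in> time_dom T"
  shows "(L has_real_derivative - K t 1) (at t within time_dom T)"
  using length_variation[OF t, of 1] velocity_endpoints[OF t] by (simp add: curve_length_eq)

section \<open>The arc length parameter, its inverse and its time derivative\<close>

lemma arc_param_has_dx:
  assumes t: "t \<in> time_dom T" and x: "x \<in> {0..1}"
  shows "(\<phi> t has_real_derivative v t x / L t) (at x within {0..1})"
proof -
  have "((\<lambda>u. integral {0..u} (v t)) has_real_derivative v t x) (at x within {0..1})"
    using integral_has_vector_derivative[OF speed_continuous_on[OF t order_refl order_refl] x]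
    by (simp add: has_real_derivative_iff_has_vector_derivative)
  from DERIV_cmult[OF this, of "1 / L t"] show ?thesis by (simp add: arc_param_def[abs_def])
qed

lemma arc_param_continuous_on: "t \<in> time_dom T \<Longrightarrow> continuous_on {0..1} (\<phi> t)"
  by (rule DERIV_continuous_on[OF arc_param_has_dx])

lemma arc_param_ends: "t \<in> time_dom T \<Longrightarrow> \<phi> t 0 = 0" "t \<in> time_dom T \<Longrightarrow> \<phi> t 1 = 1"
  using length_pos[of t] by (auto simp: arc_param_def curve_length_eq)

lemma arc_param_less:
  assumes t: "t \<in> time_dom T" and "0 \<le> a" "a < b" "b \<le> 1"
  shows "\<phi> t a < \<phi> t b"
proof -
  obtain \<xi> where "\<xi> \<in> {a<..<b}" "\<phi> t b - \<phi> t a = v t \<xi> / L t * (b - a)"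
    using mvt_unit_interval[OF arc_param_has_dx[OF t] \<open>a < b\<close>] assms by auto
  moreover have "v t \<xi> / L t * (b - a) > 0"
    using calculation(1) assms length_pos[OF t] regular[OF t, of \<xi>] by auto
  ultimately show ?thesis by linarith
qed

lemma arc_param_range:
  assumes t: "t \<in> time_dom T" and x: "x \<in> {0..1}"
  shows "\<phi> t x \<in> {0..1}"
  using arc_param_less[OF t, of 0 x] arc_param_less[OF t, of x 1] arc_param_ends[OF t] x
  by (cases "x = 0"; cases "x = 1") auto

lemma arc_param_inj: "t \<in> time_dom T \<Longrightarrow> inj_on (\<phi> t) {0..1}"
  by (rule linorder_inj_onI) (use arc_param_less in force)+

lemma arc_param_image:
  assumes t: "t \<in> time_dom T"
  shows "\<phi> t ` {0..1} = {0..1}"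
proof (intro subset_antisym subsetI)
  show "x \<in> {0..1}" if "x \<in> \<phi> t ` {0..1}" for x using that arc_param_range[OF t] by auto
  show "x \<in> \<phi> t ` {0..1}" if "x \<in> {0..1}" for x
    using IVT'[OF _ _ _ arc_param_continuous_on[OF t], of x] that arc_param_ends[OF t] by force
qed

lemma arc_param_inverse:
  assumes t: "t \<in> time_dom T" and x: "x \<in> {0..1}"
  shows "\<psi> t x \<in> {0..1}" "\<phi> t (\<psi> t x) = x" "\<psi> t (\<phi> t x) = x"
  using the_inv_into_into[OF arc_param_inj[OF t], of x "{0..1}"]
    f_the_inv_into_f[OF arc_param_inj[OF t], of x] the_inv_into_f_f[OF arc_param_inj[OF t] x]
    arc_param_image[OF t] x
  by auto

lemma arc_param_inverse_continuous_on:
  assumes t: "t \<in> time_dom T"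
  shows "continuous_on {0..1} (\<psi> t)"
  using continuous_on_inv[OF arc_param_continuous_on[OF t] compact_Icc, of "\<psi> t"]
    arc_param_image[OF t] arc_param_inverse(3)[OF t] by auto

text \<open>Quotient rule applied to the partial length over the total length, both differentiated
  by \<open>length_variation\<close>.\<close>

lemma arc_param_has_dt:
  assumes t: "t \<in> time_dom T" and y: "y \<in> {0..1}"
  shows "((\<lambda>s. \<phi> s y) has_real_derivative
    (inner (V t y) (\<tau> t y) - (K t y - \<phi> t y * K t 1)) / L t) (at t within time_dom T)"
proof -
  have L: "L t \<noteq> 0" using length_pos[OF t] by simp
  have "((\<lambda>s. integral {0..y} (v s) / L s) has_real_derivative
      ((inner (V t y) (\<tau> t y) - K t y) * L t - integral {0..y} (v t) * (- K t 1)) / (L t * L t))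
      (at t within time_dom T)"
    by (intro DERIV_divide length_variation length_has_derivative t y velocity_endpoints L)
  moreover have "((inner (V t y) (\<tau> t y) - K t y) * L t - integral {0..y} (v t) * (- K t 1)) / (L t * L t)
      = (inner (V t y) (\<tau> t y) - (K t y - \<phi> t y * K t 1)) / L t"
    using L by (simp add: arc_param_def field_simps)
  ultimately show ?thesis by (simp add: arc_param_def)
qed

lemma length_continuous_on: "continuous_on (time_dom T) L"
  by (rule DERIV_continuous_on[OF length_has_derivative])

text \<open>Evaluating at \<open>\<phi> t y\<close> makes \<open>\<psi>\<close> disappear from the
  formula. The chain rule gives V plus the time derivative of \<open>\<psi>\<close> times
  \<open>dx (f t) y\<close>, and implicit differentiation gives the former as -(D / L) / (v / L).
  The lengths cancel, dividing \<open>dx (f t) y\<close> by the speed gives the tangent, and the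
  summand \<open>inner (V t y) (\<tau> t y)\<close> of D reduces V to its normal part.\<close>

lemma const_speed_velocity:
  assumes t: "t \<in> time_dom T" and y: "y \<in> {0..1}"
  shows "dt T (\<lambda>s. const_speed (f s)) t (\<phi> t y) =
    normal_proj (f t) (V t) y + (K t y - \<phi> t y * K t 1) *\<^sub>R \<tau> t y"
proof -
  define x D where "x = \<phi> t y"
    and "D = inner (V t y) (\<tau> t y) - (K t y - \<phi> t y * K t 1)"
  have x: "x \<in> {0..1}" using arc_param_range[OF t y] by (simp add: x_def)
  have psi: "\<psi> t x = y" using arc_param_inverse(3)[OF t y] by (simp add: x_def)
  have L: "L t > 0" by (rule length_pos[OF t])
  have "((\<lambda>s. \<psi> s x) has_real_derivative - (D / L t) / (v t (\<psi> t x) / L t)) (at t within time_dom T)"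
  proof (rule implicit_inverse_has_derivative[where w = "\<lambda>s z. v s z / L s" and \<phi> = \<phi> and x = x, OF t])
    show "continuous_on (time_dom T \<times> {0..1}) (\<lambda>(s, z). v s z / L s)"
    proof -
      have "continuous_on (time_dom T \<times> {0..1}) (\<lambda>p. (\<lambda>(s, z). v s z) p / L (fst p))"
        using length_pos
        by (intro continuous_on_divide smooth_family_continuous_on smooth_speed
            continuous_on_compose2[OF length_continuous_on continuous_on_fst]) force+
      then show ?thesis by (simp add: case_prod_unfold)
    qed
    show "((\<lambda>s. \<phi> s (\<psi> t x)) has_real_derivative D / L t) (at t within time_dom T)"
      unfolding psi D_def by (rule arc_param_has_dt[OF t y])
  qed (use arc_param_has_dx arc_param_inverse x speed_pos length_pos in auto)
  then have dpsi: "((\<lambda>s. \<psi> s x) has_real_derivative - D / v t y) (at t within time_dom T)"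
    using L by (simp add: psi)
  then have inner: "((\<lambda>s. (s, \<psi> s x)) has_derivative (\<lambda>h. (h, (- D / v t y) * h))) (at t within time_dom T)"
    unfolding has_field_derivative_def by (intro has_derivative_Pair has_derivative_ident)
  \<comment> \<open>The path may run along the boundary of the domain but never leaves it, so the
    joint derivative within the domain restricts to the image of the path.\<close>
  have "(\<lambda>s. (s, \<psi> s x)) ` time_dom T \<subseteq> time_dom T \<times> {0..1}"
    using arc_param_inverse(1) x by auto
  with smooth_family_has_derivative[OF smooth t y]
  have outer: "((\<lambda>(t, x). f t x) has_derivative (\<lambda>h. fst h *\<^sub>R V t y + snd h *\<^sub>R dx (f t) y))
      (at (t, \<psi> t x) within (\<lambda>s. (s, \<psi> s x)) ` time_dom T)"
    unfolding psi by (rule has_derivative_subset)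
  have "((\<lambda>s. (\<lambda>(s, y). f s y) (s, \<psi> s x)) has_derivative
      (\<lambda>h. h *\<^sub>R V t y + ((- D / v t y) * h) *\<^sub>R dx (f t) y)) (at t within time_dom T)"
    using has_derivative_in_compose[OF inner outer] by simp
  then have "((\<lambda>s. const_speed (f s) x) has_vector_derivative V t y + (- D / v t y) *\<^sub>R dx (f t) y)
      (at t within time_dom T)"
    by (simp add: has_vector_derivative_def const_speed_def algebra_simps)
  then have "dt T (\<lambda>s. const_speed (f s)) t x = V t y + (- D / v t y) *\<^sub>R dx (f t) y"
    by (rule dt_eqI[OF t])
  also have "(- D / v t y) *\<^sub>R dx (f t) y = - D *\<^sub>R \<tau> t y"
    by (simp add: tangent_def ds_deriv_def)
  finally show ?thesis by (simp add: x_def D_def normal_proj_def algebra_simps)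
qed

text \<open>Pythagoras used twice: the normal part is orthogonal to the unit tangent, and its own
  square is that of X minus the square of the tangential component.\<close>

lemma norm_normal_proj_add_tangent:
  assumes t: "t \<in> time_dom T" and y: "y \<in> {0..1}"
  shows "(norm (normal_proj (f t) X y + c *\<^sub>R \<tau> t y))\<^sup>2
    = (norm (X y))\<^sup>2 - (inner (X y) (\<tau> t y))\<^sup>2 + c\<^sup>2"
  unfolding power2_norm_eq_inner normal_proj_def
  by (simp add: algebra_simps inner_tangent_self[OF assms] inner_commute power2_eq_square)

section \<open>The L2 estimate\<close>

lemma elastic_energy_nonneg: "t \<in> time_dom T \<Longrightarrow> 0 \<le> elastic_energy (f t)"
  unfolding elastic_energy_def ds_integral_def
  by (intro mult_nonneg_nonneg integral_nonneg integrable_continuous_interval continuous_intros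
      smooth_family_continuous_on_space[OF smooth_curvature] speed_continuous_on) auto

text \<open>The weight \<open>v\<close> is shared as a square root between the two factors, so that
  the unweighted inequality applies; 2 E is the integral of the squared curvature. The absolute
  value stays inside the integral because \<open>tangential_correction_bound\<close> produces it
  there.\<close>

lemma velocity_curvature_Cauchy_Schwarz:
  assumes t: "t \<in> time_dom T"
  shows "(integral {0..1} (\<lambda>x. \<bar>inner (V t x) (\<kappa> t x) * v t x\<bar>))\<^sup>2
    \<le> ds_integral (f t) (\<lambda>x. (norm (V t x))\<^sup>2) * (2 * elastic_energy (f t))"
proof -
  note cont = continuous_intros smooth_family_continuous_on_space[OF _ t]
    smooth_velocity smooth_curvature smooth_speed
  have "integral {0..1} (\<lambda>x. \<bar>inner (V t x) (\<kappa> t x) * v t x\<bar>)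
      \<le> integral {0..1} (\<lambda>x. (norm (V t x) * sqrt (v t x)) * (norm (\<kappa> t x) * sqrt (v t x)))"
  proof (rule integral_le)
    fix x :: real
    have "\<bar>inner (V t x) (\<kappa> t x)\<bar> * v t x \<le> (norm (V t x) * norm (\<kappa> t x)) * v t x"
      by (intro mult_right_mono Cauchy_Schwarz_ineq2) auto
    also have "\<dots> = (norm (V t x) * sqrt (v t x)) * (norm (\<kappa> t x) * sqrt (v t x))"
      by simp
    finally show "\<bar>inner (V t x) (\<kappa> t x) * v t x\<bar> \<le> \<dots>" by (simp add: abs_mult)
  qed (intro integrable_continuous_interval cont; simp)+
  then have "(integral {0..1} (\<lambda>x. \<bar>inner (V t x) (\<kappa> t x) * v t x\<bar>))\<^sup>2
      \<le> (integral {0..1} (\<lambda>x. (norm (V t x) * sqrt (v t x)) * (norm (\<kappa> t x) * sqrt (v t x))))\<^sup>2"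
    by (intro power_mono integral_nonneg integrable_continuous_interval cont; simp)
  also have "\<dots> \<le> integral {0..1} (\<lambda>x. (norm (V t x) * sqrt (v t x))\<^sup>2)
      * integral {0..1} (\<lambda>x. (norm (\<kappa> t x) * sqrt (v t x))\<^sup>2)"
    by (intro integral_Cauchy_Schwarz cont; simp)
  also have "\<dots> = ds_integral (f t) (\<lambda>x. (norm (V t x))\<^sup>2) * (2 * elastic_energy (f t))"
    by (simp add: ds_integral_def elastic_energy_def power_mult_distrib)
  finally show ?thesis .
qed

text \<open>Splitting the total integral at y turns the left side into a difference of the integrals
  over \<open>{0..y}\<close> and \<open>{y..1}\<close> with weights \<open>1 - \<phi> t y\<close>
  and \<open>\<phi> t y\<close>. Each weight is at most 1 and the two intervals together fill
  \<open>{0..1}\<close>, so the integral of the absolute value is counted only once.\<close>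

lemma tangential_correction_bound:
  assumes t: "t \<in> time_dom T" and y: "y \<in> {0..1}"
  shows "\<bar>K t y - \<phi> t y * K t 1\<bar> \<le> integral {0..1} (\<lambda>x. \<bar>inner (V t x) (\<kappa> t x) * v t x\<bar>)"
proof -
  define h where "h x = inner (V t x) (\<kappa> t x) * v t x" for x
  have cont: "continuous_on {a..b} h" if "0 \<le> a" "b \<le> 1" for a b
    unfolding h_def by (rule smooth_family_continuous_on_space[OF smooth_velocity_curvature t that])
  have int: "h integrable_on {a..b}" "(\<lambda>x. \<bar>h x\<bar>) integrable_on {a..b}" if "0 \<le> a" "b \<le> 1" for a b
    by (intro integrable_continuous_interval continuous_intros cont that)+
  have bound: "\<bar>integral {a..b} h\<bar> \<le> integral {a..b} (\<lambda>x. \<bar>h x\<bar>)" if "0 \<le> a" "b \<le> 1" for a b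
    using integral_norm_bound_integral[OF int[OF that]] by simp
  have split: "integral {0..1} h = integral {0..y} h + integral {y..1} h"
    "integral {0..1} (\<lambda>x. \<bar>h x\<bar>) = integral {0..y} (\<lambda>x. \<bar>h x\<bar>) + integral {y..1} (\<lambda>x. \<bar>h x\<bar>)"
    using y Henstock_Kurzweil_Integration.integral_combine[OF _ _ int(1), of 0 y 1]
      Henstock_Kurzweil_Integration.integral_combine[OF _ _ int(2), of 0 y 1] by auto
  have phi: "0 \<le> \<phi> t y" "\<phi> t y \<le> 1" using arc_param_range[OF t y] by auto
  have "\<bar>integral {0..y} h - \<phi> t y * integral {0..1} h\<bar>
      = \<bar>(1 - \<phi> t y) * integral {0..y} h - \<phi> t y * integral {y..1} h\<bar>"
    by (simp add: split algebra_simps)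
  also have "\<dots> \<le> (1 - \<phi> t y) * \<bar>integral {0..y} h\<bar> + \<phi> t y * \<bar>integral {y..1} h\<bar>"
    using phi by (intro order_trans[OF abs_triangle_ineq4]) (simp add: abs_mult)
  also have "\<dots> \<le> 1 * \<bar>integral {0..y} h\<bar> + 1 * \<bar>integral {y..1} h\<bar>"
    using phi by (intro add_mono mult_right_mono) auto
  also have "\<dots> \<le> integral {0..1} (\<lambda>x. \<bar>h x\<bar>)"
    using bound[of 0 y] bound[of y 1] y by (simp add: split)
  finally show ?thesis by (simp add: h_def[abs_def])
qed

lemma L2_const_speed_velocity:
  assumes t: "t \<in> time_dom T"
  shows "L2_norm_dx (dt T (\<lambda>s. const_speed (f s)) t)
    \<le> sqrt (2 / L t + 16 * elastic_energy (f t)) * L2_norm_ds (f t) (V t)"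
proof -
  define A E M where "A = ds_integral (f t) (\<lambda>x. (norm (V t x))\<^sup>2)" and "E = elastic_energy (f t)"
    and "M = A * (2 * E)"
  define R where "R y = K t y - \<phi> t y * K t 1" for y
  define G where "G x = (norm (dt T (\<lambda>s. const_speed (f s)) t x))\<^sup>2" for x
  note cont = continuous_intros smooth_family_continuous_on_space[OF _ t]
    smooth_velocity smooth_curvature smooth_speed smooth_tangent
  have L: "L t > 0" by (rule length_pos[OF t])
  have E: "0 \<le> E" unfolding E_def by (rule elastic_energy_nonneg[OF t])
  have A: "0 \<le> A" unfolding A_def ds_integral_def
    by (intro integral_nonneg integrable_continuous_interval cont) auto
  have G_phi: "G (\<phi> t y) = (norm (V t y))\<^sup>2 - (inner (V t y) (\<tau> t y))\<^sup>2 + (R y)\<^sup>2" if "y \<in> {0..1}" for y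
    unfolding G_def const_speed_velocity[OF t that] R_def norm_normal_proj_add_tangent[OF t that] ..
  have R_cont: "continuous_on {0..1} R" unfolding R_def
    by (intro continuous_intros arc_param_continuous_on[OF t] indefinite_integral_continuous_1
        integrable_continuous_interval smooth_family_continuous_on_space[OF smooth_velocity_curvature t]) auto
  \<comment> \<open>The formula for G is available only along \<open>\<phi> t\<close>. Composing it
    with \<open>\<psi> t\<close> shows that G is continuous, as substitution requires.\<close>
  have "continuous_on {0..1} (\<lambda>y. (norm (V t y))\<^sup>2 - (inner (V t y) (\<tau> t y))\<^sup>2 + (R y)\<^sup>2)"
    by (intro cont R_cont) auto
  then have "continuous_on {0..1} (\<lambda>x. (\<lambda>y. (norm (V t y))\<^sup>2 - (inner (V t y) (\<tau> t y))\<^sup>2 + (R y)\<^sup>2) (\<psi> t x))"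
    by (rule continuous_on_compose2[OF _ arc_param_inverse_continuous_on[OF t]])
      (use arc_param_inverse[OF t] in auto)
  then have "continuous_on {0..1} G"
    by (rule continuous_on_eq) (use G_phi arc_param_inverse[OF t] in metis)
  then have "((\<lambda>y. (v t y / L t) *\<^sub>R G (\<phi> t y)) has_integral integral {\<phi> t 0..\<phi> t 1} G) {0..1}"
    by (intro has_integral_substitution[of 0 1 "\<phi> t" 0 1] arc_param_has_dx t)
      (use arc_param_image[OF t] arc_param_ends[OF t] in auto)
  then have G_int: "((\<lambda>y. v t y / L t * G (\<phi> t y)) has_integral integral {0..1} G) {0..1}"
    by (simp add: arc_param_ends[OF t])
  \<comment> \<open>After substitution dx becomes \<open>v t y / L t\<close> dy. The velocity term
    thus acquires the factor 1 / L, whereas the constant M is averaged with total weight 1.\<close>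
  have "((\<lambda>y. ((norm (V t y))\<^sup>2 * v t y + M * v t y) / L t) has_integral (A + M * L t) / L t) {0..1}"
    unfolding A_def ds_integral_def curve_length_eq
    by (intro has_integral_divide has_integral_add has_integral_mult_right integrable_integral
        integrable_continuous_interval cont) auto
  with G_int have "integral {0..1} G \<le> (A + M * L t) / L t"
  proof (rule has_integral_le)
    fix y :: real assume y: "y \<in> {0..1}"
    have "\<bar>R y\<bar> ^ 2 \<le> (integral {0..1} (\<lambda>x. \<bar>inner (V t x) (\<kappa> t x) * v t x\<bar>)) ^ 2"
      using tangential_correction_bound[OF t y] by (intro power_mono) (auto simp: R_def)
    also have "\<dots> \<le> M"
      unfolding M_def A_def E_def by (rule velocity_curvature_Cauchy_Schwarz[OF t])
    finally have "(R y)\<^sup>2 \<le> M" by simp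
    then have "G (\<phi> t y) \<le> (norm (V t y))\<^sup>2 + M"
      using G_phi[OF y] zero_le_power2[of "inner (V t y) (\<tau> t y)"] by linarith
    then have "v t y / L t * G (\<phi> t y) \<le> v t y / L t * ((norm (V t y))\<^sup>2 + M)"
      using L by (intro mult_left_mono) auto
    then show "v t y / L t * G (\<phi> t y) \<le> ((norm (V t y))\<^sup>2 * v t y + M * v t y) / L t"
      by (simp add: algebra_simps add_divide_distrib)
  qed
  also have "\<dots> = (1 / L t + 2 * E) * A" using L by (simp add: M_def field_simps)
  also have "\<dots> \<le> (2 / L t + 16 * E) * A"
    using L E A by (intro mult_right_mono add_mono divide_right_mono) auto
  finally show ?thesis
    unfolding L2_norm_dx_def L2_norm_ds_def A_def[symmetric] E_def[symmetric] G_def[symmetric]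
    by (simp flip: real_sqrt_mult)
qed

end

section \<open>First variation of the elastic energy and the flow\<close>

text \<open>The initial datum agrees with \<open>f 0\<close> only on \<open>{0..1}\<close>.
  Derivatives within this interval, and hence length and energy, do not see the difference.\<close>

lemma dx_cong:
  assumes "\<And>x. x \<in> {0..1} \<Longrightarrow> X x = Y x" "x \<in> {0..1}"
  shows "dx X x = dx Y x"
proof -
  have "(X has_vector_derivative d) (at x within {0..1}) = (Y has_vector_derivative d) (at x within {0..1})" for d
    using has_vector_derivative_transform[OF assms(2), of X Y d]
      has_vector_derivative_transform[OF assms(2), of Y X d] assms(1) by metis
  then show ?thesis by (simp add: dx_def vector_derivative_def)
qed

lemma ds_deriv_cong:
  assumes "\<And>x. x \<in> {0..1} \<Longrightarrow> c x = d x" "\<And>x. x \<in> {0..1} \<Longrightarrow> X x = Y x" "x \<in> {0..1}"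
  shows "ds_deriv c X x = ds_deriv d Y x"
  using dx_cong[of c d x] dx_cong[of X Y x] assms by (simp add: ds_deriv_def)

lemma curve_length_cong:
  assumes "\<And>x. x \<in> {0..1} \<Longrightarrow> c x = d x"
  shows "curve_length c = curve_length d"
  unfolding curve_length_def ds_integral_def
  by (intro integral_cong arg_cong2[where f = "(*)"] arg_cong[where f = norm] refl dx_cong assms)

lemma elastic_energy_cong:
  assumes "\<And>x. x \<in> {0..1} \<Longrightarrow> c x = d x"
  shows "elastic_energy c = elastic_energy d"
proof -
  have "curvature c x = curvature d x" if "x \<in> {0..1}" for x
    unfolding curvature_def by (intro ds_deriv_cong assms that)
  moreover have "dx c x = dx d x" if "x \<in> {0..1}" for x
    by (rule dx_cong[OF assms that])
  ultimately show ?thesis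
    unfolding elastic_energy_def ds_integral_def
    by (intro arg_cong2[where f = "(*)"] integral_cong refl) simp_all
qed

section \<open>The gradient as an exact derivative and the first variation of the energy\<close>

context immersed_family
begin

lemma inner_normal_proj_tangent:
  "t \<in> time_dom T \<Longrightarrow> x \<in> {0..1} \<Longrightarrow> inner (normal_proj (f t) X x) (\<tau> t x) = 0"
  by (simp add: normal_proj_def inner_diff_left inner_tangent_self)

lemma inner_elastic_grad_tangent:
  "t \<in> time_dom T \<Longrightarrow> x \<in> {0..1} \<Longrightarrow> inner (elastic_grad (f t) x) (\<tau> t x) = 0"
  by (simp add: elastic_grad_def nabla_s_def inner_normal_proj_tangent inner_curvature_tangent inner_add_left)

lemma smooth_elastic_grad: "smooth_family T (\<lambda>t. elastic_grad (f t))"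
  unfolding elastic_grad_def[abs_def] power2_norm_eq_inner
  by (intro smooth_family_add smooth_family_scaleR smooth_family_mult smooth_family_const
      smooth_family_inner smooth_nabla_s smooth_curvature)

text \<open>The vector field whose arc length derivative is the gradient of the energy.\<close>

definition W :: "real \<Rightarrow> real \<Rightarrow> 'a" where
  "W t x = nabla_s (f t) (\<kappa> t) x + (1/2 * inner (\<kappa> t x) (\<kappa> t x)) *\<^sub>R \<tau> t x"

lemma smooth_W: "smooth_family T W"
  unfolding W_def[abs_def]
  by (intro smooth_family_add smooth_family_scaleR smooth_family_mult smooth_family_const
      smooth_family_inner smooth_nabla_s smooth_curvature smooth_tangent)

text \<open>The arc length derivative of \<open>nabla_s (f t) (\<kappa> t)\<close> has tangential
  component minus the inner product of the curvature with its own derivative. Differentiating the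
  factor in front of the tangent in \<open>W\<close> supplies the opposite term, which leaves the
  second normal derivative; differentiating the tangent itself supplies the cubic term of the
  gradient.\<close>

lemma dx_W:
  assumes t: "t \<in> time_dom T" and x: "x \<in> {0..1}"
  shows "dx (W t) x = v t x *\<^sub>R elastic_grad (f t) x"
proof -
  let ?N = "\<lambda>t. nabla_s (f t) (\<kappa> t)" and ?d = "\<lambda>X. ds_deriv (f t) X x"
  have N: "smooth_family T ?N" by (intro smooth_nabla_s smooth_curvature)
  have ddN: "dx (?N t) x = v t x *\<^sub>R ?d (?N t)" and dk: "dx (\<kappa> t) x = v t x *\<^sub>R ?d (\<kappa> t)"
    by (rule dx_eq_ds_deriv[OF t x])+
  \<comment> \<open>The normal derivative of the curvature is orthogonal to the tangent;
    differentiating this relation yields the tangential component of its derivative.\<close>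
  have "((\<lambda>x. 0) has_vector_derivative
      inner (?N t x) (dx (\<tau> t) x) + inner (dx (?N t) x) (\<tau> t x)) (at x within {0..1})"
    by (rule has_vector_derivative_transform[OF x _ has_dx_inner[OF N smooth_tangent t x]])
      (simp add: nabla_s_def inner_normal_proj_tangent[OF t])
  from dx_eqI[OF x this] dx_eqI[OF x has_vector_derivative_const[of "0::real"]]
  have "v t x * (inner (?N t x) (\<kappa> t x) + inner (?d (?N t)) (\<tau> t x)) = 0"
    by (simp add: dx_tangent[OF t x] ddN algebra_simps)
  then have "inner (?d (?N t)) (\<tau> t x) = - inner (?N t x) (\<kappa> t x)"
    using regular[OF t x] by simp
  also have "\<dots> = - inner (\<kappa> t x) (?d (\<kappa> t))"
    using inner_curvature_tangent[OF t x]
    by (simp add: nabla_s_def normal_proj_def inner_diff_left inner_diff_right inner_commute)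
  finally have tang: "inner (?d (?N t)) (\<tau> t x) = - inner (\<kappa> t x) (?d (\<kappa> t))" .
  have "(W t has_vector_derivative dx (?N t) x +
      ((1/2 * inner (\<kappa> t x) (\<kappa> t x)) *\<^sub>R dx (\<tau> t) x
      + (1/2 * (inner (\<kappa> t x) (dx (\<kappa> t) x) + inner (dx (\<kappa> t) x) (\<kappa> t x))) *\<^sub>R \<tau> t x))
      (at x within {0..1})"
    unfolding W_def[abs_def]
    by (intro has_vector_derivative_add bounded_bilinear.has_vector_derivative[OF bounded_bilinear_scaleR]
        has_vector_derivative_mult_right has_dx_inner smooth_family_has_dx[OF _ t x] N smooth_tangent
        smooth_curvature t x)
  then have "dx (W t) x = dx (?N t) x +
      ((1/2 * inner (\<kappa> t x) (\<kappa> t x)) *\<^sub>R dx (\<tau> t) x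
      + (1/2 * (inner (\<kappa> t x) (dx (\<kappa> t) x) + inner (dx (\<kappa> t) x) (\<kappa> t x))) *\<^sub>R \<tau> t x)"
    by (rule dx_eqI[OF x])
  also have "\<dots> = v t x *\<^sub>R (?d (?N t) + (1/2 * inner (\<kappa> t x) (\<kappa> t x)) *\<^sub>R \<kappa> t x
      + inner (\<kappa> t x) (?d (\<kappa> t)) *\<^sub>R \<tau> t x)"
    unfolding dx_tangent[OF t x] ddN dk by (simp add: inner_commute[of "?d (\<kappa> t)"] algebra_simps)
  also have "\<dots> = v t x *\<^sub>R elastic_grad (f t) x"
    by (simp add: elastic_grad_def nabla_s_def[of _ "?N t"] normal_proj_def tang power2_norm_eq_inner)
  finally show ?thesis .
qed

text \<open>Differentiate \<open>dx_tangent\<close> in time and exchange the derivatives of the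
  tangent. Keeping the factor \<open>v t x\<close> avoids a commutator of time and arc length
  derivatives.\<close>

lemma dt_curvature:
  assumes t: "t \<in> time_dom T" and x: "x \<in> {0..1}"
  shows "v t x *\<^sub>R dt T \<kappa> t x = dx (dt T \<tau> t) x - dt T v t x *\<^sub>R \<kappa> t x"
proof -
  have "((\<lambda>s. v s x *\<^sub>R \<kappa> s x) has_vector_derivative
      v t x *\<^sub>R dt T \<kappa> t x + dt T v t x *\<^sub>R \<kappa> t x) (at t within time_dom T)"
    by (intro bounded_bilinear.has_vector_derivative[OF bounded_bilinear_scaleR]
        smooth_family_has_dt smooth_speed smooth_curvature t x)
  then have "((\<lambda>s. dx (\<tau> s) x) has_vector_derivative
      v t x *\<^sub>R dt T \<kappa> t x + dt T v t x *\<^sub>R \<kappa> t x) (at t within time_dom T)"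
    by (rule has_vector_derivative_transform[OF t, rotated]) (rule dx_tangent[OF _ x])
  from dt_eqI[of t T "\<lambda>t. dx (\<tau> t)" x, OF t this] smooth_family_dt_dx[OF smooth_tangent t x] show ?thesis
    by (simp add: eq_diff_eq)
qed

text \<open>Half the time derivative of the integrand, minus the x-derivative of
  \<open>inner (\<kappa> t x) (dt T \<tau> t x)\<close>, is
  \<open>- inner (W t x) (dx (V t) x)\<close>: this is where \<open>W\<close> comes from. Adding the
  x-derivative of \<open>inner (W t x) (V t x)\<close> leaves the gradient against V, by
  \<open>dx_W\<close>. Both exact derivatives integrate to 0, the first by the clamped tangents and
  the second by the fixed end points.\<close>

lemma energy_variation:
  assumes t: "t \<in> time_dom T" and V: "V t 0 = 0" "V t 1 = 0"
    and clamped: "dt T \<tau> t 0 = 0" "dt T \<tau> t 1 = 0"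
  shows "((\<lambda>s. elastic_energy (f s)) has_real_derivative
    ds_integral (f t) (\<lambda>x. inner (elastic_grad (f t) x) (V t x))) (at t within time_dom T)"
proof -
  define e where "e s x = inner (\<kappa> s x) (\<kappa> s x) * v s x" for s x
  have e: "smooth_family T e" unfolding e_def[abs_def]
    by (intro smooth_family_mult smooth_family_inner smooth_curvature smooth_speed)
  have dt_tau: "smooth_family T (dt T \<tau>)" by (rule smooth_family_dt[OF smooth_tangent])
  note cont = continuous_intros smooth_family_continuous_on_space[OF _ t]
  have "((\<lambda>s. 1/2 * integral {0..1} (e s)) has_real_derivative 1/2 * integral {0..1} (dt T e t))
      (at t within time_dom T)"
    using leibniz_smooth_family[OF e t, of 0 1]
    by (intro DERIV_cmult) (simp add: has_real_derivative_iff_has_vector_derivative)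
  then have E: "((\<lambda>s. elastic_energy (f s)) has_real_derivative 1/2 * integral {0..1} (dt T e t))
      (at t within time_dom T)"
    by (simp add: elastic_energy_def ds_integral_def e_def[abs_def] power2_norm_eq_inner)
  have ibp1: "((\<lambda>x. inner (\<kappa> t x) (dx (dt T \<tau> t) x) + inner (dx (\<kappa> t) x) (dt T \<tau> t x)) has_integral 0) {0..1}"
    using has_integral_derivative_unit_interval[OF has_dx_inner[OF smooth_curvature dt_tau t], of 1]
    by (simp add: clamped)
  have ibp2: "((\<lambda>x. inner (W t x) (dx (V t) x) + inner (dx (W t) x) (V t x)) has_integral 0) {0..1}"
    using has_integral_derivative_unit_interval[OF has_dx_inner[OF smooth_W smooth_velocity t], of 1]
    by (simp add: V)
  have "(dt T e t has_integral integral {0..1} (dt T e t)) {0..1}"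
    by (intro integrable_integral integrable_continuous_interval cont smooth_family_dt e) auto
  from has_integral_add[OF has_integral_diff[OF has_integral_mult_right[OF this, of "1/2"] ibp1] ibp2]
  have "((\<lambda>x. 1/2 * dt T e t x
        - (inner (\<kappa> t x) (dx (dt T \<tau> t) x) + inner (dx (\<kappa> t) x) (dt T \<tau> t x))
        + (inner (W t x) (dx (V t) x) + inner (dx (W t) x) (V t x))) has_integral
      1/2 * integral {0..1} (dt T e t)) {0..1}"
    by simp
  moreover have "1/2 * dt T e t x
        - (inner (\<kappa> t x) (dx (dt T \<tau> t) x) + inner (dx (\<kappa> t) x) (dt T \<tau> t x))
        + (inner (W t x) (dx (V t) x) + inner (dx (W t) x) (V t x))
      = inner (elastic_grad (f t) x) (V t x) * v t x" if x: "x \<in> {0..1}" for x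
  proof -
    have "((\<lambda>s. e s x) has_vector_derivative
        inner (\<kappa> t x) (\<kappa> t x) * dt T v t x
        + (inner (\<kappa> t x) (dt T \<kappa> t x) + inner (dt T \<kappa> t x) (\<kappa> t x)) * v t x) (at t within time_dom T)"
      unfolding e_def[abs_def]
      by (intro bounded_bilinear.has_vector_derivative[OF bounded_bilinear_mult] has_dt_inner
          smooth_family_has_dt smooth_speed smooth_curvature t x)
    then have "dt T e t x = inner (\<kappa> t x) (\<kappa> t x) * dt T v t x + 2 * inner (\<kappa> t x) (v t x *\<^sub>R dt T \<kappa> t x)"
      by (simp add: dt_eqI[OF t] inner_commute algebra_simps)
    also have "\<dots> = 2 * inner (\<kappa> t x) (dx (dt T \<tau> t) x) - inner (\<kappa> t x) (\<kappa> t x) * dt T v t x"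
      unfolding dt_curvature[OF t x] by (simp add: inner_diff_right)
    finally have dt_e: "dt T e t x = \<dots>" .
    \<comment> \<open>The speed is moved to the other factor, where \<open>dt_tangent\<close> makes
      it a normal projection; symmetry of that projection lets it act on the derivative of the
      curvature instead.\<close>
    have "inner (dx (\<kappa> t) x) (dt T \<tau> t x)
        = inner (ds_deriv (f t) (\<kappa> t) x) (v t x *\<^sub>R dt T \<tau> t x)"
      by (subst dx_eq_ds_deriv[OF t x]) simp
    also have "\<dots> = inner (nabla_s (f t) (\<kappa> t) x) (dx (V t) x)"
      unfolding dt_tangent[OF t x]
      by (simp add: nabla_s_def normal_proj_def inner_diff_left inner_diff_right inner_commute)
    finally have k_tau: "inner (dx (\<kappa> t) x) (dt T \<tau> t x) = \<dots>" .
    show ?thesis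
      unfolding dt_e k_tau dx_W[OF t x] dt_speed[OF t x]
      by (simp add: W_def inner_add_left inner_commute[of "dx (V t) x"] algebra_simps)
  qed
  ultimately have "((\<lambda>x. inner (elastic_grad (f t) x) (V t x) * v t x) has_integral
      1/2 * integral {0..1} (dt T e t)) {0..1}"
    by (rule has_integral_eq[rotated])
  then have eq: "ds_integral (f t) (\<lambda>x. inner (elastic_grad (f t) x) (V t x)) = 1/2 * integral {0..1} (dt T e t)"
    by (simp add: ds_integral_def integral_unique)
  show ?thesis unfolding eq by (rule E)
qed

end

section \<open>Length and energy along the flow\<close>

context pinned_family
begin

text \<open>The gradient is normal and equals \<mu> times the curvature minus the normal velocity n.
  Pairing V with the curvature and integrating gives 0 by the choice of \<mu>. Pairing the gradient
  with V gives \<mu> times that same pairing minus the square of n, so after integration only the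
  nonpositive part survives.\<close>

lemma lp_flow_monotone:
  assumes flow: "lp_elastic_flow T p0 p1 \<tau>0 \<tau>1 f0 f" and t: "t \<in> time_dom T" "0 < t"
  shows "K t 1 = 0"
    and "ds_integral (f t) (\<lambda>x. inner (elastic_grad (f t) x) (V t x)) \<le> 0"
proof -
  define \<mu> where "\<mu> = lagrange_mult (f t)"
  define B where "B = integral {0..1} (\<lambda>x. inner (\<kappa> t x) (\<kappa> t x) * v t x)"
  define G where "G = integral {0..1} (\<lambda>x. inner (elastic_grad (f t) x) (\<kappa> t x) * v t x)"
  have int: "(\<lambda>x. inner (X t x) (Y t x) * v t x) integrable_on {0..1}"
    if "smooth_family T X" "smooth_family T Y" for X Y
  proof -
    have "smooth_family T (\<lambda>t x. inner (X t x) (Y t x) * v t x)"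
      by (intro smooth_family_mult smooth_family_inner smooth_speed that)
    then show ?thesis
      by (intro integrable_continuous_interval smooth_family_continuous_on_space[OF _ t(1)]) auto
  qed
  note int_V_kappa = int[OF smooth_velocity smooth_curvature]
  note facts = inner_curvature_tangent[OF t(1)] inner_elastic_grad_tangent[OF t(1)] inner_tangent_self[OF t(1)]
  have V_eq: "V t x = - elastic_grad (f t) x + \<mu> *\<^sub>R \<kappa> t x + inner (V t x) (\<tau> t x) *\<^sub>R \<tau> t x"
    if "x \<in> {0..1}" for x
    using flow t that unfolding lp_elastic_flow_def elastic_grad_def \<mu>_def
    by (simp add: algebra_simps)
  have V_kappa: "inner (V t x) (\<kappa> t x) = - inner (elastic_grad (f t) x) (\<kappa> t x) + \<mu> * inner (\<kappa> t x) (\<kappa> t x)"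
    if x: "x \<in> {0..1}" for x
  proof -
    have "inner (V t x) (\<kappa> t x) = inner (- elastic_grad (f t) x + \<mu> *\<^sub>R \<kappa> t x
        + inner (V t x) (\<tau> t x) *\<^sub>R \<tau> t x) (\<kappa> t x)"
      using V_eq[OF x] by simp
    then show ?thesis
      using facts(1)[OF x] by (simp add: inner_add_left inner_diff_left inner_commute[of "\<tau> t x" "\<kappa> t x"])
  qed
  show K0: "K t 1 = 0"
  proof (cases "B = 0")
    \<comment> \<open>Here the multiplier is a division by 0, with value 0, and carries no
      information. But the curvature then has zero L2 norm, and Cauchy-Schwarz forces the pairing
      with V to vanish.\<close>
    case True
    then have "2 * elastic_energy (f t) = 0"
      by (simp add: B_def elastic_energy_def ds_integral_def power2_norm_eq_inner)
    with velocity_curvature_Cauchy_Schwarz[OF t(1)]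
    have "integral {0..1} (\<lambda>x. \<bar>inner (V t x) (\<kappa> t x) * v t x\<bar>) = 0" by simp
    moreover have "\<bar>K t 1\<bar> \<le> integral {0..1} (\<lambda>x. \<bar>inner (V t x) (\<kappa> t x) * v t x\<bar>)"
      unfolding real_norm_def[symmetric]
    proof (rule integral_norm_bound_integral[OF int_V_kappa])
      show "(\<lambda>x. norm (inner (V t x) (\<kappa> t x) * v t x)) integrable_on {0..1}"
        by (intro integrable_continuous_interval continuous_on_norm
            smooth_family_continuous_on_space[OF smooth_velocity_curvature t(1)]) auto
    qed simp
    ultimately show ?thesis by simp
  next
    case False
    have "((\<lambda>x. - (inner (elastic_grad (f t) x) (\<kappa> t x) * v t x) + \<mu> * (inner (\<kappa> t x) (\<kappa> t x) * v t x))
        has_integral - G + \<mu> * B) {0..1}"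
      unfolding G_def B_def
      by (intro has_integral_add has_integral_neg has_integral_mult_right integrable_integral
          int smooth_elastic_grad smooth_curvature)
    then have "((\<lambda>x. inner (V t x) (\<kappa> t x) * v t x) has_integral - G + \<mu> * B) {0..1}"
      by (rule has_integral_eq[rotated]) (simp add: V_kappa algebra_simps)
    moreover have "\<mu> = G / B"
      by (simp add: \<mu>_def lagrange_mult_def ds_integral_def G_def B_def power2_norm_eq_inner)
    ultimately show ?thesis using False by (simp add: integral_unique)
  qed
  define n where "n x = V t x - inner (V t x) (\<tau> t x) *\<^sub>R \<tau> t x" for x
  have "inner (elastic_grad (f t) x) (V t x) \<le> \<mu> * inner (V t x) (\<kappa> t x)" if x: "x \<in> {0..1}" for x
  proof -
    have g: "elastic_grad (f t) x = \<mu> *\<^sub>R \<kappa> t x - n x"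
      using V_eq[OF x] by (simp add: n_def algebra_simps)
    \<comment> \<open>The gradient is normal, so the unprescribed tangential velocity does not
      contribute to the energy balance.\<close>
    have "inner (elastic_grad (f t) x) (V t x) = inner (elastic_grad (f t) x) (n x)"
      using facts(2)[OF x] by (simp add: n_def inner_diff_right)
    also have "\<dots> = \<mu> * inner (\<kappa> t x) (n x) - inner (n x) (n x)"
      unfolding g by (simp add: inner_diff_left)
    also have "inner (\<kappa> t x) (n x) = inner (V t x) (\<kappa> t x)"
      using facts(1)[OF x] by (simp add: n_def inner_diff_right inner_commute)
    finally show ?thesis by simp
  qed
  then have "integral {0..1} (\<lambda>x. inner (elastic_grad (f t) x) (V t x) * v t x)
      \<le> integral {0..1} (\<lambda>x. \<mu> * (inner (V t x) (\<kappa> t x) * v t x))"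
    using int[OF smooth_elastic_grad smooth_velocity] integrable_on_mult_right[OF int_V_kappa, of \<mu>]
    by (intro integral_le) (auto simp flip: mult.assoc intro!: mult_right_mono)
  also have "\<dots> = \<mu> * K t 1" by simp
  finally show "ds_integral (f t) (\<lambda>x. inner (elastic_grad (f t) x) (V t x)) \<le> 0"
    using K0 by (simp add: ds_integral_def)
qed

text \<open>The signs of the derivatives are known only at positive times, where the flow equation
  holds. The argument therefore uses two-sided derivatives on the open interval from 0 to t and
  continuity on the closed one. Constancy of the end tangents supplies the clamping that
  \<open>energy_variation\<close> requires.\<close>

lemma lp_flow_length_energy:
  assumes flow: "lp_elastic_flow T p0 p1 \<tau>0 \<tau>1 f0 f" and t: "t \<in> time_dom T"
  shows "curve_length (f t) = curve_length f0" "elastic_energy (f t) \<le> elastic_energy f0"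
proof -
  let ?E = "\<lambda>s. elastic_energy (f s)"
  have "0 \<le> t" using t by (simp add: time_dom_def)
  have sub: "{0..t} \<subseteq> time_dom T" using time_domE[OF t] by (metis atLeastatMost_subset_iff order_refl less_imp_le subset_trans)
  have at: "at s within time_dom T = at s" if "0 < s" "s < t" for s
    by (rule at_within_open_subset[of _ "{0<..<t}"]) (use that sub in auto)
  have "dt T \<tau> s y = 0" if s: "s \<in> time_dom T" and y: "y = 0 \<or> y = 1" for s y
  proof (rule dt_eqI[OF s])
    show "((\<lambda>s. \<tau> s y) has_vector_derivative 0) (at s within time_dom T)"
      by (rule has_vector_derivative_transform[OF s _ has_vector_derivative_const[of "\<tau> s y"]])
        (use y flow s in \<open>auto simp: lp_elastic_flow_def\<close>)
  qed
  then have E: "(?E has_real_derivative ds_integral (f s) (\<lambda>x. inner (elastic_grad (f s) x) (V s x)))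
      (at s within time_dom T)" if "s \<in> time_dom T" for s
    using that velocity_endpoints by (intro energy_variation) auto
  have f0: "f0 x = f 0 x" if "x \<in> {0..1}" for x
    using flow that by (simp add: lp_elastic_flow_def)
  have contE: "continuous_on {0..t} ?E"
    by (rule continuous_on_subset[OF DERIV_continuous_on[OF E] sub])
  have "?E t \<le> ?E 0"
  proof (rule DERIV_nonpos_imp_decreasing_open[OF \<open>0 \<le> t\<close> _ contE])
    fix s assume s: "0 < s" "s < t"
    then have "s \<in> time_dom T" using sub by auto
    from E[OF this] lp_flow_monotone(2)[OF flow this s(1)] at[OF s]
    show "\<exists>y. (?E has_real_derivative y) (at s) \<and> y \<le> 0" by auto
  qed
  then show "elastic_energy (f t) \<le> elastic_energy f0"
    using elastic_energy_cong[of f0 "f 0", OF f0] by simp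
  have "L t = L 0"
  proof (cases "t = 0")
    case False
    have "(L has_real_derivative 0) (at s)" if s: "0 < s" "s < t" for s
    proof -
      have "s \<in> time_dom T" using s sub by auto
      from length_has_derivative[OF this] lp_flow_monotone(1)[OF flow this s(1)] at[OF s]
      show ?thesis by simp
    qed
    then show ?thesis
      using DERIV_isconst2[of 0 t L t] False \<open>0 \<le> t\<close> continuous_on_subset[OF length_continuous_on sub]
      by auto
  qed simp
  then show "curve_length (f t) = curve_length f0"
    using curve_length_cong[of f0 "f 0", OF f0] by simp
qed

end

theorem lemma4p10:
  fixes T :: ereal and p0 p1 :: "real ^ 'd"
    and f :: "real \<Rightarrow> real \<Rightarrow> real ^ 'd"
  assumes dim: "CARD('d) \<ge> 2"
    and T: "0 < T"
    and smooth: "smooth_family T f"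
    and immersed: "\<forall>t\<in>time_dom T. immersed (f t)"
    and endpoints: "\<forall>t\<in>time_dom T. f t 0 = p0 \<and> f t 1 = p1"
    and length_pos: "\<forall>t\<in>time_dom T. curve_length (f t) > 0"
  shows "(\<forall>t\<in>time_dom T.
            L2_norm_dx (dt T (\<lambda>s. const_speed (f s)) t)
              \<le> sqrt (2 / curve_length (f t) + 16 * elastic_energy (f t))
                 * L2_norm_ds (f t) (dt T f t)) \<and>
         (\<forall>(f0 :: real \<Rightarrow> real ^ 'd) \<tau>0 \<tau>1.
            norm \<tau>0 = 1 \<longrightarrow> norm \<tau>1 = 1 \<longrightarrow>
            f0 0 = p0 \<longrightarrow> f0 1 = p1 \<longrightarrow>
            tangent f0 0 = \<tau>0 \<longrightarrow> tangent f0 1 = \<tau>1 \<longrightarrow>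
            norm (p0 - p1) < curve_length f0 \<longrightarrow>
            lp_elastic_flow T p0 p1 \<tau>0 \<tau>1 f0 f \<longrightarrow>
            (\<forall>t\<in>time_dom T.
               L2_norm_dx (dt T (\<lambda>s. const_speed (f s)) t)
                 \<le> sqrt (2 / curve_length f0 + 16 * elastic_energy f0)
                    * L2_norm_ds (f t) (dt T f t)))"
proof (intro conjI ballI allI impI)
  interpret pinned_family T f p0 p1
    by unfold_locales (use smooth immersed endpoints length_pos in \<open>auto simp: immersed_def\<close>)
  fix t assume t: "t \<in> time_dom T"
  show bound: "L2_norm_dx (dt T (\<lambda>s. const_speed (f s)) t)
      \<le> sqrt (2 / curve_length (f t) + 16 * elastic_energy (f t)) * L2_norm_ds (f t) (dt T f t)"
    by (rule L2_const_speed_velocity[OF t])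
  fix f0 :: "real \<Rightarrow> real ^ 'd" and \<tau>0 \<tau>1
  assume flow: "lp_elastic_flow T p0 p1 \<tau>0 \<tau>1 f0 f"
  have "0 \<le> L2_norm_ds (f t) (dt T f t)"
    unfolding L2_norm_ds_def ds_integral_def
    by (intro real_sqrt_ge_zero integral_nonneg integrable_continuous_interval continuous_intros
        smooth_family_continuous_on_space[OF smooth_velocity t] speed_continuous_on[OF t]) auto
  then have "sqrt (2 / curve_length (f t) + 16 * elastic_energy (f t)) * L2_norm_ds (f t) (dt T f t)
      \<le> sqrt (2 / curve_length f0 + 16 * elastic_energy f0) * L2_norm_ds (f t) (dt T f t)"
    using lp_flow_length_energy[OF flow t] by (intro mult_right_mono real_sqrt_le_mono) auto
  with bound show "L2_norm_dx (dt T (\<lambda>s. const_speed (f s)) t)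
      \<le> sqrt (2 / curve_length f0 + 16 * elastic_energy f0) * L2_norm_ds (f t) (dt T f t)"
    by (rule order_trans)
qed

end
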